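(* Let $f$ be a polynomial of degree $d\geq 2$ with complex coefficients, let $G$ be a Siegel disk of $f$, and let $A$ be an arc contained in the boundary $\partial G$. If two (distinct) internal rays from $G$ land on $A$, then $\partial G$ is a Jordan curve.
   Context: A polynomial $f$ is regarded as a rational map of the Riemann sphere $\overline{\mathbb{C}}$. A component $G$ of the Fatou set of $f$ is a Siegel disk if $f(G)=G$, $G$ contains a neutral fixed point $w_0$ (that is, $f(w_0)=w_0$ and $|f'(w_0)|=1$), and $f|_G$ is analytically conjugate to a rotation. It is known that then $f'(w_0)=e^{2\pi i\theta}$ with $\theta$ irrational. Let $\mathbb{D}$ be the open unit disk and let $\varphi\colon\mathbb{D}\to G$ be the Riemann map of the conjugation: a conformal isomorphism with $\varphi(0)=w_0$ and $f(\varphi(z))=\varphi(e^{2\pi i\theta}z)$ for all $z\in\mathbb{D}$. An internal ray of $G$ is the image $\{\varphi(r\zeta):0\le r<1\}$ of a radius of $\mathbb{D}$, where $|\zeta|=1$; it lands on $A$ if the limit $\lim_{r\to1^-}\varphi(r\zeta)$ exists and belongs to $A$. An arc is a space homeomorphic to $[0,1]$; a Jordan curve is a space homeomorphic to the circle $S^1$. *)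

theory Defs
  imports "HOL-Complex_Analysis.Complex_Analysis" "HOL-Computational_Algebra.Computational_Algebra"
begin

datatype rsphere = Fin complex | Infty

primrec stereo :: "rsphere \<Rightarrow> complex \<times> real" where
  "stereo (Fin z) = (2 * z / of_real (1 + (norm z)\<^sup>2), ((norm z)\<^sup>2 - 1) / (1 + (norm z)\<^sup>2))"
| "stereo Infty = (0, 1)"

lemma inj_stereo: "inj stereo"
proof (rule injI)
  have pos: "1 + (norm z)\<^sup>2 > 0" for z :: complex
    by (smt (verit) zero_le_power2)
  have third: "((norm z)\<^sup>2 - 1) / (1 + (norm z)\<^sup>2) = 1 - 2 / (1 + (norm z)\<^sup>2)" for z :: complex
    using pos[of z] by (simp add: field_simps)
  fix x y assume eq: "stereo x = stereo y"
  show "x = y"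
  proof (cases x; cases y)
    fix z w assume x: "x = Fin z" and y: "y = Fin w"
    have "2 / (1 + (norm z)\<^sup>2) = 2 / (1 + (norm w)\<^sup>2)"
      using eq unfolding x y by (simp add: third)
    hence n: "(norm z)\<^sup>2 = (norm w)\<^sup>2"
      using pos[of z] pos[of w] by (simp add: field_simps)
    have "of_real (1 + (norm w)\<^sup>2) \<noteq> (0::complex)"
      using pos[of w] by (metis less_irrefl of_real_eq_0_iff)
    with eq n show "x = y" unfolding x y by simp
  next
    fix z assume "x = Fin z" "y = Infty"
    with eq pos[of z] third[of z] show "x = y" by simp
  next
    fix w assume "x = Infty" "y = Fin w"
    with eq pos[of w] third[of w] show "x = y" by simp
  qed simp
qed

text \<open>The Riemann sphere carries the chordal metric, pulled back from the unit sphere in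
  \<open>complex \<times> real\<close> by inverse stereographic projection from the north pole \<open>(0, 1)\<close>.\<close>

instantiation rsphere :: metric_space
begin

definition dist_rsphere :: "rsphere \<Rightarrow> rsphere \<Rightarrow> real" where
  "dist_rsphere x y = dist (stereo x) (stereo y)"

definition uniformity_rsphere :: "(rsphere \<times> rsphere) filter" where
  "uniformity_rsphere = (INF e\<in>{0<..}. principal {(x, y). dist x y < e})"

definition open_rsphere :: "rsphere set \<Rightarrow> bool" where
  "open_rsphere U \<longleftrightarrow> (\<forall>x\<in>U. \<forall>\<^sub>F (x', y) in uniformity. x' = x \<longrightarrow> y \<in> U)"

instance
proof
  fix x y z :: rsphere
  show "dist x y = 0 \<longleftrightarrow> x = y"
    by (simp add: dist_rsphere_def inj_eq[OF inj_stereo])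
  show "dist x y \<le> dist x z + dist y z"
    by (simp add: dist_rsphere_def dist_triangle2)
qed (simp_all add: uniformity_rsphere_def open_rsphere_def)

end

text \<open>A polynomial as a self-map of the sphere; the value at \<open>Infty\<close> is the
  continuous extension only for nonconstant \<open>p\<close>.\<close>

primrec sphere_map :: "complex poly \<Rightarrow> rsphere \<Rightarrow> rsphere" where
  "sphere_map p (Fin z) = Fin (poly p z)"
| "sphere_map p Infty = Infty"

definition normal_family_on :: "rsphere set \<Rightarrow> (rsphere \<Rightarrow> rsphere) set \<Rightarrow> bool" where
  "normal_family_on U \<F> \<longleftrightarrow>
     (\<forall>g :: nat \<Rightarrow> rsphere \<Rightarrow> rsphere. range g \<subseteq> \<F> \<longrightarrow>
        (\<exists>r h. strict_mono r \<and>
           (\<forall>K. compact K \<and> K \<subseteq> U \<longrightarrow> uniform_limit K (\<lambda>n. g (r n)) h sequentially)))"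

definition fatou_set :: "(rsphere \<Rightarrow> rsphere) \<Rightarrow> rsphere set" where
  "fatou_set f = {x. \<exists>U. open U \<and> x \<in> U \<and> normal_family_on U (range (\<lambda>n. f ^^ n))}"

text \<open>The conjugating map takes values in the plane: near \<open>Infty\<close> a polynomial of degree at least 2
  is not injective, so no domain containing \<open>Infty\<close> admits such a conjugation.
  The inverse of a holomorphic bijection between domains is automatically holomorphic.\<close>

definition conjugates_rotation ::
    "complex poly \<Rightarrow> rsphere set \<Rightarrow> complex \<Rightarrow> (complex \<Rightarrow> complex) \<Rightarrow> bool" where
  "conjugates_rotation p G \<rho> \<phi> \<longleftrightarrow>
     \<phi> holomorphic_on ball 0 1 \<and> bij_betw (\<lambda>z. Fin (\<phi> z)) (ball 0 1) G \<and>
     (\<forall>z\<in>ball 0 1. poly p (\<phi> z) = \<phi> (\<rho> * z))"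

definition siegel_disk :: "complex poly \<Rightarrow> complex \<Rightarrow> rsphere set \<Rightarrow> bool" where
  "siegel_disk p w\<^sub>0 G \<longleftrightarrow>
     G \<in> components (fatou_set (sphere_map p)) \<and> sphere_map p ` G = G \<and>
     Fin w\<^sub>0 \<in> G \<and> poly p w\<^sub>0 = w\<^sub>0 \<and> norm (poly (pderiv p) w\<^sub>0) = 1 \<and>
     (\<exists>\<rho> \<phi>. norm \<rho> = 1 \<and> conjugates_rotation p G \<rho> \<phi>)"

text \<open>The irrationality of \<open>\<theta>\<close> is not demanded: it follows for Siegel disks of
  polynomials of degree at least 2, since otherwise an iterate would be the identity.\<close>

definition siegel_riemann_map ::
    "complex poly \<Rightarrow> complex \<Rightarrow> rsphere set \<Rightarrow> real \<Rightarrow> (complex \<Rightarrow> complex) \<Rightarrow> bool" where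
  "siegel_riemann_map p w\<^sub>0 G \<theta> \<phi> \<longleftrightarrow>
     poly (pderiv p) w\<^sub>0 = exp (2 * of_real pi * \<i> * of_real \<theta>) \<and> \<phi> 0 = w\<^sub>0 \<and>
     conjugates_rotation p G (exp (2 * of_real pi * \<i> * of_real \<theta>)) \<phi>"

definition internal_ray :: "(complex \<Rightarrow> complex) \<Rightarrow> complex \<Rightarrow> rsphere set" where
  "internal_ray \<phi> \<zeta> = (\<lambda>r. Fin (\<phi> (of_real r * \<zeta>))) ` {0..<1::real}"

definition ray_lands_on :: "(complex \<Rightarrow> complex) \<Rightarrow> complex \<Rightarrow> rsphere set \<Rightarrow> bool" where
  "ray_lands_on \<phi> \<zeta> A \<longleftrightarrow>
     (\<exists>a\<in>A. ((\<lambda>r. Fin (\<phi> (of_real r * \<zeta>))) \<longlongrightarrow> a) (at_left (1::real)))"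

definition is_arc :: "'a::topological_space set \<Rightarrow> bool" where
  "is_arc A \<longleftrightarrow> A homeomorphic {0..1::real}"

definition is_jordan_curve :: "'a::topological_space set \<Rightarrow> bool" where
  "is_jordan_curve J \<longleftrightarrow> J homeomorphic sphere (0::complex) 1"

end

theory Submission
  imports Defs
begin

text \<open>
  Write \<open>\<Omega>\<close> for the Siegel disk in the plane, \<open>\<phi>\<close> for its Riemann map, and \<open>radius t\<close> and \<open>sector a b\<close>
  for the radii and sectors of the unit disk. The proof has a topological, an analytic and a dynamical
  ingredient.

  \<^emph>\<open>Loops in the closure of the disk are filled by the disk.\<close> The iterates of \<open>p\<close> are uniformly bounded
  on \<open>closure \<Omega>\<close>, so by the maximum principle and Montel's theorem the inside of every Jordan curve in
  \<open>closure \<Omega>\<close> belongs to the Fatou set and misses \<open>frontier \<Omega>\<close>. Consequently, if two rays and a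
  subset of the frontier make up a Jordan curve, its inside is the image of one of the two
  sectors between the rays (\<open>loop_inside\<close>).

  \<^emph>\<open>A bounded holomorphic function on a bounded domain is determined by its values along a boundary
  arc\<close>, provided the arc can be approached from outside the closure (\<open>boundary_uniqueness\<close>). Applied to
  \<open>\<phi>\<close> this shows that distinct rays never land at the same point (\<open>rays_landing_same_point\<close>).

  The two given rays therefore land at distinct points of the arc, and with the sub-arc between these
  points they bound the image of a sector. The images of the given rays under the iterates of \<open>p\<close> are
  landing rays as well, and they are dense because the rotation is irrational. Inside the
  sector their landing points move monotonically along the arc (\<open>split_trace\<close>). If the landing
  points skipped an open piece of the arc at some angle, the inverse of \<open>\<phi>\<close> would be constant along
  that piece, which \<open>boundary_uniqueness\<close> excludes; hence \<open>\<phi>\<close> has a limit at every point of the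
  circular arc that bounds the sector (\<open>boundary_limit\<close>).

  \<^emph>\<open>The rotation\<close> spreads these limits to the whole circle (\<open>limits_everywhere\<close>). The
  extension of \<open>\<phi>\<close> maps the circle continuously onto \<open>frontier \<Omega>\<close>, injectively since distinct rays
  have distinct landing points, and so the frontier is a Jordan curve.
\<close>

section \<open>Boundary values of holomorphic functions\<close>

text \<open>Compactness inside \<open>V\<close> takes the place of continuity up to the frontier: a set \<open>{z \<in> V. norm (F z) \<ge> c}\<close> with
  \<open>c > B\<close> stays away from the frontier and is therefore compact, so \<open>norm \<circ> F\<close> attains its maximum
  over \<open>V\<close> there.\<close>

lemma maximum_modulus_boundary_values:
  fixes F :: "complex \<Rightarrow> complex"
  assumes "open V" "connected V" "bounded V" and hol: "F holomorphic_on V"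
    and bd: "\<And>u e. \<lbrakk>u \<in> frontier V; e > 0\<rbrakk> \<Longrightarrow> \<forall>\<^sub>F z in at u within V. norm (F z) \<le> B + e"
    and v: "v \<in> V"
  shows "norm (F v) \<le> B"
proof (rule ccontr)
  assume "\<not> norm (F v) \<le> B"
  define e where "e = (norm (F v) - B) / 2"
  have "e > 0" and less: "B + e < norm (F v)"
    using \<open>\<not> norm (F v) \<le> B\<close> by (auto simp: e_def field_simps)
  define T where "T = {z \<in> V. norm (F z) \<ge> norm (F v)}"
  have contF: "continuous_on V F"
    by (rule holomorphic_on_imp_continuous_on[OF hol])
  have "closed T"
    unfolding closed_sequential_limits
  proof (intro allI impI, elim conjE)
    fix x l assume x: "\<forall>n. x n \<in> T" and lim: "x \<longlonglongrightarrow> l"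
    have xV: "x n \<in> V" and xl: "norm (F (x n)) \<ge> norm (F v)" for n
      using x by (auto simp: T_def)
    have "l \<in> closure V" using xV lim closure_sequential by blast
    show "l \<in> T"
    proof (cases "l \<in> V")
      case True
      have "(\<lambda>n. F (x n)) \<longlonglongrightarrow> F l"
        using continuous_on_tendsto_compose[OF contF lim True] xV by simp
      then have "norm (F v) \<le> norm (F l)"
        by (intro LIMSEQ_le_const[OF tendsto_norm]) (use xl in auto)
      then show ?thesis using True by (simp add: T_def)
    next
      case False
      then have "l \<in> frontier V"
        using \<open>l \<in> closure V\<close> \<open>open V\<close> by (simp add: frontier_def interior_open)
      from bd[OF this \<open>e > 0\<close>] have ev: "\<forall>\<^sub>F z in at l within V. norm (F z) \<le> B + e" .
      have "filterlim x (at l within V) sequentially"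
        unfolding filterlim_at using lim xV False by (metis (mono_tags, lifting) always_eventually)
      then have "\<forall>\<^sub>F n in sequentially. norm (F (x n)) \<le> B + e"
        using ev unfolding filterlim_iff by blast
      then obtain n where "norm (F (x n)) \<le> B + e"
        using eventually_sequentially by auto
      with xl[of n] less show ?thesis by simp
    qed
  qed
  then have "compact T"
    using bounded_subset[OF \<open>bounded V\<close>, of T] by (auto simp: T_def compact_eq_bounded_closed)
  moreover have "v \<in> T" using v by (simp add: T_def)
  moreover have "continuous_on T (\<lambda>z. norm (F z))"
    by (intro continuous_on_norm continuous_on_subset[OF contF]) (auto simp: T_def)
  ultimately obtain \<xi> where \<xi>: "\<xi> \<in> T" "\<And>z. z \<in> T \<Longrightarrow> norm (F z) \<le> norm (F \<xi>)"
    using continuous_attains_sup[of T "\<lambda>z. norm (F z)"] by blast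
  have max: "norm (F z) \<le> norm (F \<xi>)" if "z \<in> V" for z
    using \<xi> that by (cases "norm (F z) \<ge> norm (F v)") (auto simp: T_def)
  have "F constant_on V"
    by (rule maximum_modulus_principle[OF hol \<open>open V\<close> \<open>connected V\<close> \<open>open V\<close> order_refl _ max])
      (use \<xi> in \<open>auto simp: T_def\<close>)
  then have const: "F z = F v" if "z \<in> V" for z
    using that v by (auto simp: constant_on_def)
  have "V \<noteq> UNIV" using \<open>bounded V\<close> not_bounded_UNIV by metis
  then obtain u where u: "u \<in> frontier V"
    using v frontier_not_empty by blast
  then have "u \<in> closure V" "u \<notin> V"
    using \<open>open V\<close> by (auto simp: frontier_def interior_open)
  then have "at u within V \<noteq> bot"
    by (simp add: closure_def trivial_limit_within)
  moreover have "\<forall>\<^sub>F z in at u within V. z \<in> V"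
    by (simp add: eventually_at_topological) auto
  with bd[OF u \<open>e > 0\<close>] have "\<forall>\<^sub>F z in at u within V. False"
    by eventually_elim (use const less in auto)
  ultimately show False by simp
qed

text \<open>The hypothesis on \<open>u\<^sub>0\<close> provides a point \<open>s\<close> outside \<open>closure V\<close> close to \<open>u\<^sub>0\<close>.
  The multiple \<open>q\<close> of \<open>1 / (w - s)\<close> is bounded on \<open>V\<close>, at most 1 in modulus on the part of the frontier
  where nothing is known about \<open>h\<close>, and at least 2 in modulus near \<open>u\<^sub>0\<close>. The maximum principle bounds
  \<open>h * q ^ n\<close> by the bound of \<open>h\<close> for every \<open>n\<close>, which forces \<open>h = 0\<close> where \<open>\<bar>q\<bar> \<ge> 2\<close>.\<close>

lemma boundary_uniqueness:
  fixes h :: "complex \<Rightarrow> complex"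
  assumes V: "open V" "connected V" "bounded V" and hol: "h holomorphic_on V"
    and bh: "bounded (h ` V)"
    and u0: "u\<^sub>0 \<in> closure (- closure V)" and "d > 0"
    and zero: "\<And>u. \<lbrakk>u \<in> frontier V; dist u u\<^sub>0 < d\<rbrakk> \<Longrightarrow> (h \<longlongrightarrow> 0) (at u within V)"
    and v: "v \<in> V" "dist v u\<^sub>0 < d / 8"
  shows "h v = 0"
proof -
  obtain M where M: "\<And>z. z \<in> V \<Longrightarrow> norm (h z) \<le> M" and "M > 0"
    using bh by (auto simp: bounded_pos)
  obtain s where s: "s \<notin> closure V" "dist s u\<^sub>0 < d / 8"
    using closure_approachable[THEN iffD1, OF u0, rule_format, of "d / 8"] \<open>d > 0\<close> by auto
  \<comment> \<open>The factor \<open>d / 2\<close> is below the distance from \<open>s\<close> to the far part of the frontier, which is at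
    least \<open>7 * d / 8\<close>, and at least twice the distance from \<open>s\<close> to \<open>v\<close>, which is at most \<open>d / 4\<close>.\<close>
  define q where "q = (\<lambda>w::complex. of_real (d / 2) / (w - s))"
  have nq: "norm (q w) = d / 2 / norm (w - s)" for w
    unfolding q_def norm_divide norm_of_real using \<open>d > 0\<close> by simp
  have "V \<subseteq> closure V" by (rule closure_subset)
  then have ns: "w \<noteq> s" if "w \<in> V" for w using that s by auto
  have holF: "(\<lambda>w. h w * q w ^ n) holomorphic_on V" for n
    unfolding q_def by (intro holomorphic_intros hol) (use ns in auto)
  have bound: "norm (h v * q v ^ n) \<le> M" for n
  proof (rule maximum_modulus_boundary_values[OF V holF _ v(1)])
    fix u and e :: real assume u: "u \<in> frontier V" and "e > 0"
    then have "u \<noteq> s" using s by (auto simp: frontier_def)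
    then have q: "(q \<longlongrightarrow> q u) (at u within V)"
      unfolding q_def by (intro tendsto_intros) auto
    show "\<forall>\<^sub>F z in at u within V. norm (h z * q z ^ n) \<le> M + e"
    proof (cases "dist u u\<^sub>0 < d")
      case True
      have "((\<lambda>w. h w * q w ^ n) \<longlongrightarrow> 0 * q u ^ n) (at u within V)"
        by (intro tendsto_intros q zero[OF u True])
      then have "\<forall>\<^sub>F z in at u within V. dist (h z * q z ^ n) 0 < M + e"
        using \<open>e > 0\<close> \<open>M > 0\<close> by (intro tendstoD) auto
      then show ?thesis by eventually_elim auto
    next
      case False
      have "norm (u - s) \<ge> d * 7 / 8"
        using False s(2) dist_triangle[of u u\<^sub>0 s] by (simp add: dist_norm norm_minus_commute)
      then have "norm (q u) < 1"
        using \<open>d > 0\<close> \<open>u \<noteq> s\<close> by (simp add: nq divide_less_eq)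
      then have "\<forall>\<^sub>F z in at u within V. norm (q z) < 1"
        using order_tendstoD(2)[OF tendsto_norm[OF q]] by blast
      moreover have "\<forall>\<^sub>F z in at u within V. z \<in> V"
        by (simp add: eventually_at_topological) auto
      ultimately show ?thesis
      proof eventually_elim
        case (elim z)
        have "norm (q z) ^ n \<le> 1" using elim by (intro power_le_one) auto
        then have "norm (h z) * norm (q z) ^ n \<le> M * 1"
          using M[OF elim(2)] \<open>M > 0\<close> by (intro mult_mono) auto
        then show ?case using \<open>e > 0\<close> by (simp add: norm_mult norm_power)
      qed
    qed
  qed
  have "norm (v - s) \<le> d / 4"
    using v(2) s(2) dist_triangle[of v s u\<^sub>0] by (simp add: dist_norm norm_minus_commute)
  then have "norm (q v) \<ge> 2"
    using \<open>d > 0\<close> ns[OF v(1)] by (simp add: nq le_divide_eq)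
  then have le: "norm (h v) * 2 ^ n \<le> M" for n
    using bound[of n] mult_left_mono[OF power_mono[of 2 "norm (q v)" n], of "norm (h v)"]
    by (simp add: norm_mult norm_power)
  show ?thesis
  proof (rule ccontr)
    assume "h v \<noteq> 0"
    then obtain n where "M / norm (h v) < 2 ^ n"
      using real_arch_pow[of 2 "M / norm (h v)"] by auto
    then show False using le[of n] \<open>h v \<noteq> 0\<close> by (simp add: field_simps)
  qed
qed

lemma tendsto_unique_cluster_value:
  fixes f :: "'a::first_countable_topology \<Rightarrow> 'b::heine_borel"
  assumes "bounded (f ` S)"
    and uniq: "\<And>x u. \<lbrakk>\<And>n. x n \<in> S; x \<longlonglongrightarrow> \<zeta>; (\<lambda>n. f (x n)) \<longlonglongrightarrow> u\<rbrakk> \<Longrightarrow> u = v"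
  shows "(f \<longlongrightarrow> v) (at \<zeta> within S)"
  unfolding tendsto_at_iff_sequentially
proof (intro allI impI)
  fix X assume X: "\<forall>i. X i \<in> S - {\<zeta>}" "X \<longlonglongrightarrow> \<zeta>"
  show "(f \<circ> X) \<longlonglongrightarrow> v"
  proof (rule ccontr)
    assume "\<not> (f \<circ> X) \<longlonglongrightarrow> v"
    then obtain e where "e > 0" and e: "\<not> (\<forall>\<^sub>F n in sequentially. dist ((f \<circ> X) n) v < e)"
      by (auto simp: tendsto_iff)
    obtain r :: "nat \<Rightarrow> nat" where r: "strict_mono r" "\<And>n. \<not> dist ((f \<circ> X) (r n)) v < e"
      using not_eventually_sequentiallyD[OF e] by auto
    have "bounded (range (f \<circ> X \<circ> r))"
      by (rule bounded_subset[OF assms(1)]) (use X in auto)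
    from bounded_imp_convergent_subsequence[OF this]
    obtain l r' where l: "strict_mono r'" "((f \<circ> X \<circ> r) \<circ> r') \<longlonglongrightarrow> l" by auto
    have "l = v"
    proof (rule uniq[of "X \<circ> r \<circ> r'"])
      show "(X \<circ> r \<circ> r') \<longlonglongrightarrow> \<zeta>"
        by (intro LIMSEQ_subseq_LIMSEQ X r l)
      show "(\<lambda>n. f ((X \<circ> r \<circ> r') n)) \<longlonglongrightarrow> l"
        using l(2) by (simp add: o_def)
    qed (use X in auto)
    then have "\<forall>\<^sub>F n in sequentially. dist (((f \<circ> X \<circ> r) \<circ> r') n) v < e"
      using l(2) \<open>e > 0\<close> by (auto simp: tendsto_iff)
    then show False
      using r(2) by (auto simp: eventually_sequentially)
  qed
qed

section \<open>Radii and sectors of the unit disk\<close>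

definition radius :: "real \<Rightarrow> complex set" where
  "radius t = {of_real r * cis t | r. 0 \<le> r \<and> r < 1}"

definition sector :: "real \<Rightarrow> real \<Rightarrow> complex set" where
  "sector a b = {of_real r * cis t | r t. 0 < r \<and> r < 1 \<and> a < t \<and> t < b}"

lemma radius_subset: "radius t \<subseteq> ball 0 1"
  by (auto simp: radius_def norm_mult)

lemma sector_subset: "sector a b \<subseteq> ball 0 1"
  by (auto simp: sector_def norm_mult)

lemma radius_2pi [simp]: "radius (t + 2 * pi) = radius t"
proof -
  have "cis (t + 2 * pi) = cis t" by (simp flip: cis_mult)
  then show ?thesis by (simp add: radius_def)
qed

lemma cis_eq_close:
  assumes "cis s = cis t" "\<bar>s - t\<bar> < 2 * pi"
  shows "s = t"
proof -
  have "cis (s - t) = 1" using assms(1) by (simp flip: cis_divide)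
  then have "cos (s - t) = 1" by (simp add: complex_eq_iff)
  then obtain n :: int where n: "s - t = of_int n * 2 * pi"
    by (auto simp: cos_one_2pi_int)
  have "\<bar>of_int n * 2 * pi\<bar> < 2 * pi" using assms(2) n by simp
  then have "\<bar>of_int n :: real\<bar> < 1" by (simp add: abs_mult)
  then have "n = 0" by linarith
  then show ?thesis using n by simp
qed

lemma polar_eq:
  assumes "of_real r * cis s = of_real r' * cis t" "0 < r" "0 \<le> r'"
  shows "r = r' \<and> cis s = cis t"
proof -
  have "norm (of_real r * cis s) = norm (of_real r' * cis t)" using assms(1) by simp
  then have "r = r'" using assms(2,3) by (simp add: norm_mult)
  then show ?thesis using assms by simp
qed

lemma polar_coordinates:
  assumes "z \<noteq> 0"
  obtains t where "a < t" "t \<le> a + 2 * pi" "z = of_real (norm z) * cis t"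
proof
  define w where "w = z * cis (- a - pi)"
  show "a < Arg w + a + pi" "Arg w + a + pi \<le> a + 2 * pi"
    using Arg_bounded[of w] by auto
  have "w = of_real (norm w) * cis (Arg w)"
    by (simp add: rcis_cmod_Arg flip: rcis_def)
  then have "w = of_real (norm z) * cis (Arg w)"
    by (simp add: w_def norm_mult)
  then have "w * cis (a + pi) = of_real (norm z) * (cis (Arg w) * cis (a + pi))"
    by (metis mult.assoc)
  then have "w * cis (a + pi) = of_real (norm z) * cis (Arg w + a + pi)"
    by (simp add: cis_mult add.assoc)
  then show "z = of_real (norm z) * cis (Arg w + a + pi)"
    by (simp add: w_def mult.assoc cis_mult)
qed

lemma radius_Int_radius:
  assumes "a < b" "b < a + 2 * pi"
  shows "radius a \<inter> radius b = {0}"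
proof -
  have "z = 0" if z: "z \<in> radius a" "z \<in> radius b" for z
  proof (rule ccontr)
    assume "z \<noteq> 0"
    obtain r where r: "z = of_real r * cis a" "0 \<le> r"
      using z(1) by (auto simp: radius_def)
    obtain s where s: "z = of_real s * cis b" "0 \<le> s"
      using z(2) by (auto simp: radius_def)
    from r have "r > 0" using \<open>z \<noteq> 0\<close> by (cases "r = 0") auto
    then have "cis a = cis b" using polar_eq[of r a s b] r s by auto
    then show False using cis_eq_close[of a b] assms by auto
  qed
  moreover have "0 \<in> radius t" for t
    by (auto simp: radius_def)
  ultimately show ?thesis by blast
qed

lemma sector_Int_radius:
  assumes "c \<le> a" "b \<le> c + 2 * pi"
  shows "sector a b \<inter> radius c = {}"
proof -
  have False if "0 < r" "0 \<le> r'" "a < t" "t < b" "of_real r * cis t = of_real r' * cis c" for r r' t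
    using polar_eq[OF that(5,1,2)] cis_eq_close[of t c] that assms by auto
  then show ?thesis unfolding sector_def radius_def by blast
qed

lemma sector_Int_sector:
  assumes "b \<le> c" "d \<le> a + 2 * pi"
  shows "sector a b \<inter> sector c d = {}"
proof -
  have False if "0 < r" "0 < r'" "a < s" "s < b" "c < t" "t < d"
     "of_real r * cis s = of_real r' * cis t" for r r' s t
    using polar_eq[OF that(7,1)] cis_eq_close[of s t] that assms by auto
  then show ?thesis unfolding sector_def by blast
qed

lemma ball_eq_radii_sectors:
  assumes "a < b" "b < a + 2 * pi" "z \<in> ball 0 1" "z \<notin> radius a" "z \<notin> radius b"
  shows "z \<in> sector a b \<union> sector b (a + 2 * pi)"
proof -
  have "0 \<in> radius a" by (auto simp: radius_def)
  then have "z \<noteq> 0" using assms by auto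
  then obtain t where t: "a < t" "t \<le> a + 2 * pi" "z = of_real (norm z) * cis t"
    by (rule polar_coordinates)
  have "t \<noteq> b" using t assms by (auto simp: radius_def)
  have "z \<notin> radius (a + 2 * pi)" using assms by simp
  then have "t \<noteq> a + 2 * pi"
    using t(3) assms(3) unfolding radius_def by auto
  moreover have "0 < norm z" "norm z < 1"
    using assms(3) \<open>z \<noteq> 0\<close> by auto
  ultimately show ?thesis
    using \<open>t \<noteq> b\<close> t unfolding sector_def by (cases "t < b") force+
qed

text \<open>Seen as the exponential of a convex strip, a sector is connected and, by the open mapping
  theorem, open, whatever its opening.\<close>

lemma sector_eq_exp: "sector a b = exp ` {w. Re w < 0 \<and> a < Im w \<and> Im w < b}" (is "_ = exp ` ?R")
proof
  show "sector a b \<subseteq> exp ` ?R"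
  proof
    fix z assume "z \<in> sector a b"
    then obtain r t where "z = of_real r * cis t" "0 < r" "r < 1" "a < t" "t < b"
      by (auto simp: sector_def)
    then have "z = exp (Complex (ln r) t)" "Complex (ln r) t \<in> ?R"
      by (auto simp: exp_eq_polar)
    then show "z \<in> exp ` ?R" by blast
  qed
  show "exp ` ?R \<subseteq> sector a b"
    by (auto simp: sector_def exp_eq_polar intro!: exI)
qed

lemma sector_rectangle:
  fixes a b :: real
  defines "R \<equiv> {w. Re w < 0 \<and> a < Im w \<and> Im w < b}"
  shows "open R" "convex R"
proof -
  have R: "R = {w. Re w < 0} \<inter> {w. a < Im w} \<inter> {w. Im w < b}"
    by (auto simp: R_def)
  show "open R"
    unfolding R
    by (intro open_Int open_halfspace_Re_lt open_halfspace_Im_gt open_halfspace_Im_lt)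
  show "convex R"
    unfolding R
    by (intro convex_Int convex_halfspace_Re_lt convex_halfspace_Im_gt convex_halfspace_Im_lt)
qed

lemma connected_sector: "connected (sector a b)"
  unfolding sector_eq_exp
  by (intro connected_continuous_image continuous_intros convex_connected sector_rectangle)

lemma open_sector: "open (sector a b)"
  unfolding sector_eq_exp
proof (rule open_mapping_thm[of exp UNIV])
  show "\<not> exp constant_on (UNIV :: complex set)"
  proof
    assume "exp constant_on (UNIV :: complex set)"
    then have "exp 0 = exp (\<i> * of_real pi)"
      unfolding constant_on_def by (metis UNIV_I)
    then show False by (simp add: exp_pi_i')
  qed
qed (auto intro: holomorphic_intros sector_rectangle)

lemma cis_neighbourhood:
  assumes "a < \<tau>" "\<tau> < b"
  obtains d where "d > 0"
    "\<And>z. dist z (cis \<tau>) < d \<Longrightarrow> \<exists>t. a < t \<and> t < b \<and> 0 < norm z \<and> z = of_real (norm z) * cis t"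
proof -
  define A where "A = (\<lambda>z. Arg (z * cis (- \<tau>)))"
  have A0: "A (cis \<tau>) = 0" by (simp add: A_def cis_mult)
  have "isCont Arg (cis \<tau> * cis (- \<tau>))"
    by (rule continuous_at_Arg) (simp add: cis_mult)
  then have "((\<lambda>z. Arg (z * cis (- \<tau>))) \<longlongrightarrow> Arg (cis \<tau> * cis (- \<tau>))) (at (cis \<tau>))"
    by (rule isCont_tendsto_compose) (intro tendsto_intros)
  then have "(A \<longlongrightarrow> 0) (at (cis \<tau>))"
    using A0 by (simp add: A_def)
  moreover have "min (\<tau> - a) (b - \<tau>) > 0" using assms by simp
  ultimately have "\<forall>\<^sub>F z in at (cis \<tau>). dist (A z) 0 < min (\<tau> - a) (b - \<tau>)"
    by (rule tendstoD)
  then obtain d where d: "d > 0"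
      "\<And>z. \<lbrakk>z \<noteq> cis \<tau>; dist z (cis \<tau>) < d\<rbrakk> \<Longrightarrow> \<bar>A z\<bar> < min (\<tau> - a) (b - \<tau>)"
    unfolding eventually_at dist_real_def diff_zero by blast
  show ?thesis
  proof
    show "min d 1 > 0" using d by simp
    fix z assume z: "dist z (cis \<tau>) < min d 1"
    then have "z \<noteq> 0" by auto
    have "\<bar>A z\<bar> < min (\<tau> - a) (b - \<tau>)"
      using d(2)[of z] z A0 assms by (cases "z = cis \<tau>") auto
    moreover have "z = of_real (norm z) * cis (\<tau> + A z)"
    proof -
      have "z * cis (- \<tau>) = of_real (norm (z * cis (- \<tau>))) * cis (A z)"
        unfolding A_def by (simp add: rcis_cmod_Arg flip: rcis_def)
      then have "z * cis (- \<tau>) * cis \<tau> = of_real (norm z) * cis (\<tau> + A z)"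
        by (simp add: norm_mult cis_mult mult.assoc add.commute)
      then show ?thesis by (simp add: mult.assoc cis_mult)
    qed
    ultimately show "\<exists>t. a < t \<and> t < b \<and> 0 < norm z \<and> z = of_real (norm z) * cis t"
      using \<open>z \<noteq> 0\<close> by (intro exI[of _ "\<tau> + A z"]) auto
  qed
qed

lemma eventually_in_sector:
  assumes "a < \<tau>" "\<tau> < b" "\<And>n. x n \<in> ball 0 1" "x \<longlonglongrightarrow> cis \<tau>"
  shows "\<forall>\<^sub>F n in sequentially. x n \<in> sector a b"
proof -
  obtain d where d: "d > 0"
    "\<And>z. dist z (cis \<tau>) < d \<Longrightarrow> \<exists>t. a < t \<and> t < b \<and> 0 < norm z \<and> z = of_real (norm z) * cis t"
    using cis_neighbourhood[OF assms(1,2)] by blast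
  have "\<forall>\<^sub>F n in sequentially. dist (x n) (cis \<tau>) < d"
    using assms(4) d(1) by (rule tendstoD)
  then show ?thesis
  proof eventually_elim
    case (elim n)
    then obtain t where "a < t" "t < b" "0 < norm (x n)" "x n = of_real (norm (x n)) * cis t"
      using d(2) by blast
    moreover have "norm (x n) < 1" using assms(3)[of n] by simp
    ultimately show ?case
      unfolding sector_def by blast
  qed
qed

lemma eventually_in_closure:
  assumes "\<forall>\<^sub>F n in sequentially. x n \<in> S" "x \<longlonglongrightarrow> u"
  shows "u \<in> closure S"
proof (rule Lim_in_closed_set[OF closed_closure _ trivial_limit_sequentially assms(2)])
  show "\<forall>\<^sub>F n in sequentially. x n \<in> closure S"
    using assms(1) by (rule eventually_mono) (use closure_subset in auto)
qed

section \<open>Conformal images of the disk and their landing rays\<close>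

text \<open>The last assumption is the form in which the dynamics enters the plane topology. For the
  image \<open>\<Omega>\<close> of the disk in a Siegel disk it expresses that the frontier of \<open>\<Omega>\<close> lies in the Julia set,
  whereas the inside of a loop in \<open>closure \<Omega>\<close> has bounded orbits and lies in the Fatou set.\<close>

locale disk_map =
  fixes \<phi> :: "complex \<Rightarrow> complex"
  assumes holomorphic: "\<phi> holomorphic_on ball 0 1"
    and injective: "inj_on \<phi> (ball 0 1)"
    and bounded_image: "bounded (\<phi> ` ball 0 1)"
    and full: "\<And>c. \<lbrakk>simple_path c; pathfinish c = pathstart c; path_image c \<subseteq> closure (\<phi> ` ball 0 1)\<rbrakk>
      \<Longrightarrow> inside (path_image c) \<inter> frontier (\<phi> ` ball 0 1) = {}"
begin

abbreviation \<Omega> :: "complex set" where "\<Omega> \<equiv> \<phi> ` ball 0 1"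

definition \<psi> :: "complex \<Rightarrow> complex" where "\<psi> = the_inv_into (ball 0 1) \<phi>"

lemma \<psi>_\<phi> [simp]: "z \<in> ball 0 1 \<Longrightarrow> \<psi> (\<phi> z) = z"
  unfolding \<psi>_def by (rule the_inv_into_f_f[OF injective])

lemma continuous_\<phi>: "continuous_on (ball 0 1) \<phi>"
  by (rule holomorphic_on_imp_continuous_on[OF holomorphic])

lemma open_\<Omega>: "open \<Omega>"
  by (rule open_mapping_thm3[OF holomorphic _ injective]) simp

lemma holomorphic_\<psi>: "\<psi> holomorphic_on \<Omega>"
proof -
  obtain g where g: "g holomorphic_on \<Omega>" "\<And>z. z \<in> ball 0 1 \<Longrightarrow> g (\<phi> z) = z"
    using holomorphic_has_inverse[OF holomorphic _ injective] by (metis open_ball)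
  show ?thesis
    by (rule holomorphic_transform[OF g(1)]) (use g(2) in auto)
qed

lemma continuous_\<psi>: "continuous_on \<Omega> \<psi>"
  by (rule holomorphic_on_imp_continuous_on[OF holomorphic_\<psi>])

lemma frontier_\<Omega>: "frontier \<Omega> = closure \<Omega> - \<Omega>"
  by (simp add: frontier_def interior_open open_\<Omega>)

text \<open>The homeomorphism \<open>\<phi>\<close> onto \<open>\<Omega>\<close> is proper, and this lemma and the next express it through
  sequences.\<close>

lemma limit_in_frontier:
  assumes "\<And>n. x n \<in> ball 0 1" "x \<longlonglongrightarrow> \<zeta>" "norm \<zeta> = 1" "(\<lambda>n. \<phi> (x n)) \<longlonglongrightarrow> u"
  shows "u \<in> frontier \<Omega>"
proof -
  have "u \<in> closure \<Omega>"
    by (rule eventually_in_closure[OF _ assms(4)]) (use assms(1) in simp)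
  moreover have "u \<notin> \<Omega>"
  proof
    assume u: "u \<in> \<Omega>"
    have "(\<lambda>n. \<psi> (\<phi> (x n))) \<longlonglongrightarrow> \<psi> u"
      using continuous_on_tendsto_compose[OF continuous_\<psi> assms(4) u] assms(1) by simp
    then have "x \<longlonglongrightarrow> \<psi> u"
      using assms(1) by simp
    then have "\<psi> u = \<zeta>"
      using assms(2) LIMSEQ_unique by blast
    then show False
      using u assms(3) by auto
  qed
  ultimately show ?thesis by (simp add: frontier_\<Omega>)
qed

lemma norm_limit_eq_1:
  assumes "\<And>n. x n \<in> ball 0 1" "x \<longlonglongrightarrow> \<xi>" "(\<lambda>n. \<phi> (x n)) \<longlonglongrightarrow> u" "u \<notin> \<Omega>"
  shows "norm \<xi> = 1"
proof -
  have "norm \<xi> \<le> 1"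
    by (rule LIMSEQ_le_const2[OF tendsto_norm[OF assms(2)]])
      (use assms(1) in \<open>auto intro!: less_imp_le\<close>)
  moreover have "\<not> norm \<xi> < 1"
  proof
    assume "norm \<xi> < 1"
    then have "\<xi> \<in> ball 0 1" by simp
    then have "(\<lambda>n. \<phi> (x n)) \<longlonglongrightarrow> \<phi> \<xi>"
      using continuous_on_tendsto_compose[OF continuous_\<phi> assms(2)] assms(1) by simp
    then have "u = \<phi> \<xi>" using assms(3) LIMSEQ_unique by blast
    then show False using assms(4) \<open>\<xi> \<in> ball 0 1\<close> by simp
  qed
  ultimately show ?thesis by simp
qed

text \<open>Rays are indexed by their angle, so that \<open>t\<close> and \<open>t + 2 * pi\<close> denote the same ray; this keeps
  cyclic order on the circle a matter of linear inequalities between angles.\<close>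

definition lands :: "real \<Rightarrow> complex \<Rightarrow> bool" where
  "lands t q \<longleftrightarrow> ((\<lambda>r. \<phi> (of_real r * cis t)) \<longlongrightarrow> q) (at_left 1)"

lemma lands_2pi [simp]: "lands (t + 2 * pi) q \<longleftrightarrow> lands t q"
proof -
  have "cis (t + 2 * pi) = cis t" by (simp flip: cis_mult)
  then show ?thesis by (simp add: lands_def)
qed

lemma lands_sequence:
  assumes "lands t q"
  obtains r :: "nat \<Rightarrow> real" where "\<And>n. 0 < r n" "\<And>n. r n < 1" "r \<longlonglongrightarrow> 1"
    "(\<lambda>n. \<phi> (of_real (r n) * cis t)) \<longlonglongrightarrow> q"
proof
  define r :: "nat \<Rightarrow> real" where "r n = 1 - inverse (real (n + 2))" for n
  show "0 < r n" "r n < 1" for n by (simp_all add: r_def field_simps)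
  have "(\<lambda>n. 1 - inverse (real (n + 2))) \<longlonglongrightarrow> 1 - 0"
    by (intro tendsto_intros LIMSEQ_ignore_initial_segment[OF lim_inverse_n])
  then show "r \<longlonglongrightarrow> 1" by (simp add: r_def[abs_def])
  then have "filterlim r (at_left 1) sequentially"
    using \<open>\<And>n. r n < 1\<close> by (auto simp: filterlim_at less_imp_neq)
  then show "(\<lambda>n. \<phi> (of_real (r n) * cis t)) \<longlonglongrightarrow> q"
    using assms unfolding lands_def by (rule filterlim_compose[rotated])
qed

lemma lands_in_frontier:
  assumes "lands t q"
  shows "q \<in> frontier \<Omega>"
proof -
  obtain r where r: "\<And>n. 0 < r n" "\<And>n. r n < 1" "r \<longlonglongrightarrow> 1"
    "(\<lambda>n. \<phi> (of_real (r n) * cis t)) \<longlonglongrightarrow> q"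
    using lands_sequence[OF assms] by blast
  have "(\<lambda>n. of_real (r n) * cis t) \<longlonglongrightarrow> of_real 1 * cis t"
    by (intro tendsto_intros r)
  then show ?thesis
    by (intro limit_in_frontier[OF _ _ _ r(4), of "cis t"]) (use r in \<open>auto simp: norm_mult less_imp_le\<close>)
qed

lemma lands_in_closure_sector:
  assumes "lands t q" "a < t" "t < b"
  shows "q \<in> closure (\<phi> ` sector a b)"
proof -
  obtain r where r: "\<And>n. 0 < r n" "\<And>n. r n < 1" "r \<longlonglongrightarrow> 1"
    "(\<lambda>n. \<phi> (of_real (r n) * cis t)) \<longlonglongrightarrow> q"
    using lands_sequence[OF assms(1)] by blast
  have "\<phi> (of_real (r n) * cis t) \<in> \<phi> ` sector a b" for n
    unfolding sector_def using r(1,2)[of n] assms by blast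
  then show ?thesis
    by (intro eventually_in_closure[OF _ r(4)]) simp
qed

definition ray :: "real \<Rightarrow> complex \<Rightarrow> real \<Rightarrow> complex" where
  "ray t q r = (if r < 1 then \<phi> (of_real r * cis t) else q)"

lemma pathstart_ray [simp]: "pathstart (ray t q) = \<phi> 0"
  and pathfinish_ray [simp]: "pathfinish (ray t q) = q"
  by (simp_all add: pathstart_def pathfinish_def ray_def)

lemma path_image_ray: "path_image (ray t q) = insert q (\<phi> ` radius t)"
proof -
  have "{0..1::real} = insert 1 {0..<1}" by auto
  moreover have "radius t = (\<lambda>r. of_real r * cis t) ` {0..<1}"
    by (auto simp: radius_def)
  ultimately show ?thesis
    by (auto simp: path_image_def ray_def image_iff)
qed

lemma arc_ray:
  assumes "lands t q"
  shows "arc (ray t q)"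
  unfolding arc_def path_def
proof
  have q: "q \<notin> \<Omega>" using lands_in_frontier[OF assms] by (simp add: frontier_\<Omega>)
  show "continuous_on {0..1} (ray t q)"
    unfolding continuous_on_def
  proof
    fix x :: real assume x: "x \<in> {0..1}"
    show "(ray t q \<longlongrightarrow> ray t q x) (at x within {0..1})"
    proof (cases "x < 1")
      case True
      have "of_real x * cis t \<in> ball 0 1" using x True by (simp add: norm_mult)
      then have "isCont \<phi> (of_real x * cis t)"
        using continuous_\<phi> by (simp add: continuous_on_eq_continuous_at)
      then have "((\<lambda>r. \<phi> (of_real r * cis t)) \<longlongrightarrow> \<phi> (of_real x * cis t)) (at x within {0..1})"
        by (rule isCont_tendsto_compose) (intro tendsto_intros)
      moreover have "\<forall>\<^sub>F r in at x within {0..1}. r < 1"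
        using True by (intro order_tendstoD(2)[OF tendsto_ident_at])
      then have "\<forall>\<^sub>F r in at x within {0..1}. \<phi> (of_real r * cis t) = ray t q r"
        by eventually_elim (simp add: ray_def)
      ultimately show ?thesis
        using True by (simp add: ray_def[of t q x] tendsto_cong)
    next
      case False
      then have [simp]: "x = 1" using x by simp
      have ev: "\<forall>\<^sub>F r in at_left (1::real). \<phi> (of_real r * cis t) = ray t q r"
        unfolding eventually_at_filter by (simp add: ray_def)
      have "(ray t q \<longlongrightarrow> q) (at_left 1)"
        using assms tendsto_cong[OF ev] unfolding lands_def by simp
      moreover have "at (1::real) within {0..1} \<le> at_left 1"
        by (simp add: at_within_Icc_at_left)
      ultimately show ?thesis
        by (simp add: ray_def[of t q 1] tendsto_mono)
    qed
  qed
  show "inj_on (ray t q) {0..1}"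
  proof (rule inj_onI)
    have inj: "r = s" if "\<phi> (of_real r * cis t) = \<phi> (of_real s * cis t)"
      "0 \<le> r" "0 \<le> s" "r < 1" "s < 1" for r s :: real
      using inj_onD[OF injective that(1)] that(2-) by (auto simp: norm_mult)
    have nq: "\<phi> (of_real r * cis t) \<noteq> q" if "0 \<le> r" "r < 1" for r :: real
      using q that by (auto simp: norm_mult image_iff)
    fix r s assume "r \<in> {0..1}" "s \<in> {0..1}" "ray t q r = ray t q s"
    then show "r = s"
      using inj[of r s] nq[of r] nq[of s] by (auto simp: ray_def split: if_splits)
  qed
qed

end

section \<open>Loops formed by landing rays\<close>

context disk_map
begin

text \<open>The inside avoids \<open>frontier \<Omega>\<close> and touches \<open>\<Omega>\<close>, hence lies in \<open>\<Omega>\<close>. Its preimage is a connected set that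
  avoids both radii, so it sits in one of the two sectors; the image of that sector is in turn
  connected and avoids the loop, so it cannot leave the inside.\<close>

lemma loop_inside:
  assumes c: "simple_path c" "pathfinish c = pathstart c"
    and img: "path_image c = \<phi> ` (radius a \<union> radius b) \<union> B" and B: "B \<subseteq> frontier \<Omega>"
    and ab: "a < b" "b < a + 2 * pi"
  shows "inside (path_image c) = \<phi> ` sector a b \<or> inside (path_image c) = \<phi> ` sector b (a + 2 * pi)"
proof -
  define I where "I = inside (path_image c)"
  have I: "I \<noteq> {}" "open I" "connected I" "frontier I = path_image c" "I \<inter> path_image c = {}"
    using Jordan_inside_outside[OF c] by (auto simp: I_def)
  have sub: "\<phi> ` (radius a \<union> radius b) \<subseteq> \<Omega>"
    using radius_subset by blast
  have "path_image c \<subseteq> closure \<Omega>"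
    unfolding img using B sub closure_subset[of \<Omega>] unfolding frontier_\<Omega> by blast
  then have If: "I \<inter> frontier \<Omega> = {}"
    unfolding I_def by (rule full[OF c])
  have "0 \<in> radius a" by (auto simp: radius_def)
  then have "\<phi> 0 \<in> closure I" "\<phi> 0 \<in> \<Omega>"
    using img I(4) by (auto simp: frontier_def)
  then have "I \<inter> \<Omega> \<noteq> {}"
    using open_\<Omega> open_Int_closure_eq_empty by blast
  then have I\<Omega>: "I \<subseteq> \<Omega>"
    using connected_Int_frontier[OF I(3), of \<Omega>] If by auto
  define P where "P = \<psi> ` I"
  have IP: "I = \<phi> ` P"
    using I\<Omega> by (force simp: P_def)
  have P: "P \<subseteq> ball 0 1" using I\<Omega> by (auto simp: P_def)
  have "connected P"
    unfolding P_def by (intro connected_continuous_image I continuous_on_subset[OF continuous_\<psi> I\<Omega>])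
  have "z \<notin> radius a \<union> radius b" if "z \<in> P" for z
    using that I(5) img unfolding IP by blast
  then have PS: "P \<subseteq> sector a b \<union> sector b (a + 2 * pi)"
    using ball_eq_radii_sectors[OF ab] P by blast
  have "sector a b \<inter> sector b (a + 2 * pi) = {}"
    by (rule sector_Int_sector) auto
  with PS have "P \<subseteq> sector a b \<or> P \<subseteq> sector b (a + 2 * pi)"
    using connectedD[OF \<open>connected P\<close> open_sector[of a b] open_sector[of b "a + 2 * pi"]] by blast
  moreover have "I = \<phi> ` S" if S: "P \<subseteq> S" "connected S" "S \<subseteq> ball 0 1" "S \<inter> (radius a \<union> radius b) = {}" for S
  proof
    show "I \<subseteq> \<phi> ` S" using IP S by blast
    have conn: "connected (\<phi> ` S)"
      by (intro connected_continuous_image S continuous_on_subset[OF continuous_\<phi>])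
    have "\<phi> ` S \<inter> \<phi> ` (radius a \<union> radius b) = {}"
      using inj_on_image_Int[OF injective S(3), of "radius a \<union> radius b"] S(4) radius_subset by auto
    moreover have "\<phi> ` S \<inter> B = {}"
      using S(3) B by (auto simp: frontier_\<Omega>)
    ultimately have "\<phi> ` S \<inter> frontier I = {}"
      using I(4) img by auto
    moreover have "\<phi> ` S \<inter> I \<noteq> {}"
      using I(1) IP S by blast
    ultimately show "\<phi> ` S \<subseteq> I"
      using connected_Int_frontier[OF conn, of I] by blast
  qed
  moreover have "sector a b \<inter> (radius a \<union> radius b) = {}"
    using sector_Int_radius[of a a b] sector_Int_radius[of "b - 2 * pi" a b]
      radius_2pi[of "b - 2 * pi"] ab by auto
  moreover have "sector b (a + 2 * pi) \<inter> (radius a \<union> radius b) = {}"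
    using sector_Int_radius[of a b "a + 2 * pi"] sector_Int_radius[of b b "a + 2 * pi"] ab by auto
  ultimately show ?thesis
    unfolding I_def[symmetric] using connected_sector sector_subset by meson
qed

lemma loop_trace:
  assumes "simple_path c" "pathfinish c = pathstart c"
    and img: "path_image c = \<phi> ` (radius a \<union> radius b) \<union> B"
    and S: "inside (path_image c) = \<phi> ` S" "S \<subseteq> ball 0 1"
  shows "closure (\<phi> ` S) \<inter> frontier \<Omega> \<subseteq> B"
proof -
  have "closure (\<phi> ` S) = \<phi> ` S \<union> path_image c"
    using Jordan_inside_outside[OF assms(1,2)] unfolding S(1)
    by (metis closure_Un_frontier)
  moreover have "\<phi> ` (radius a \<union> radius b) \<subseteq> \<Omega>" "\<phi> ` S \<subseteq> \<Omega>"
    using radius_subset S(2) by blast+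
  ultimately show ?thesis
    unfolding img frontier_\<Omega> by blast
qed

text \<open>If two rays landed at one point \<open>q\<close>, they would close up to a loop whose inside is the image of
  a sector. The closure of this image meets \<open>frontier \<Omega>\<close> in \<open>q\<close> alone, so \<open>\<phi>\<close> would have the constant
  boundary value \<open>q\<close> along an arc of the circle and would be constant near that arc.\<close>

lemma rays_landing_same_point:
  assumes ab: "a < b" "b < a + 2 * pi" and "lands a q" "lands b q"
  shows False
proof -
  have q: "q \<in> frontier \<Omega>" using lands_in_frontier assms by blast
  define c where "c = ray a q +++ reversepath (ray b q)"
  have "\<phi> ` radius a \<inter> \<phi> ` radius b = {\<phi> 0}"
    using inj_on_image_Int[OF injective radius_subset radius_subset, of a b] radius_Int_radius[OF ab]
    by simp
  then have "path_image (ray a q) \<inter> path_image (reversepath (ray b q)) \<subseteq> {\<phi> 0, q}"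
    by (auto simp: path_image_ray)
  then have c: "simple_path c" "pathfinish c = pathstart c"
    unfolding c_def
    by (auto intro!: simple_path_join_loop arc_ray arc_reversepath assms)
  have img: "path_image c = \<phi> ` (radius a \<union> radius b) \<union> {q}"
    unfolding c_def by (subst path_image_join) (auto simp: path_image_ray)
  obtain a' b' where ab': "a' < b'" "inside (path_image c) = \<phi> ` sector a' b'"
    using loop_inside[OF c img _ ab] q ab by (metis empty_subsetI insert_subset)
  have trace: "closure (\<phi> ` sector a' b') \<inter> frontier \<Omega> \<subseteq> {q}"
    by (rule loop_trace[OF c img ab'(2) sector_subset])
  define m where "m = (a' + b') / 2"
  have m: "a' < m" "m < b'" using ab' by (simp_all add: m_def)
  obtain d where d: "d > 0"
    "\<And>z. dist z (cis m) < d \<Longrightarrow> \<exists>t. a' < t \<and> t < b' \<and> 0 < norm z \<and> z = of_real (norm z) * cis t"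
    using cis_neighbourhood[OF m] by blast
  have const: "\<phi> v - q = 0" if v: "v \<in> ball 0 1" "dist v (cis m) < d / 8" for v
  proof (rule boundary_uniqueness[OF _ _ _ _ _ _ d(1) _ v])
    show "(\<lambda>z. \<phi> z - q) holomorphic_on ball 0 1"
      by (intro holomorphic_intros holomorphic)
    have "bounded ((\<lambda>z. z - q) ` \<Omega>)"
      using bounded_translation[OF bounded_image, of "- q"] by (simp add: add.commute)
    then show "bounded ((\<lambda>z. \<phi> z - q) ` ball 0 1)"
      by (simp add: image_image)
    have "closure (- cball 0 1 :: complex set) = - ball 0 1"
      by (simp add: closure_complement)
    then show "cis m \<in> closure (- closure (ball 0 1))"
      by simp
    fix u assume "u \<in> frontier (ball 0 1 :: complex set)" "dist u (cis m) < d"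
    then have "norm u = 1" "\<exists>t. a' < t \<and> t < b' \<and> 0 < norm u \<and> u = of_real (norm u) * cis t"
      using d(2)[of u] by auto
    then obtain t where t: "a' < t" "t < b'" "u = cis t" by auto
    have "(\<phi> \<longlongrightarrow> q) (at u within ball 0 1)"
    proof (rule tendsto_unique_cluster_value[OF bounded_image])
      fix x w assume x: "\<And>n. x n \<in> ball 0 1" "x \<longlonglongrightarrow> u" "(\<lambda>n. \<phi> (x n)) \<longlonglongrightarrow> w"
      have "w \<in> frontier \<Omega>"
        by (rule limit_in_frontier[OF x(1,2) _ x(3)]) (simp add: t)
      moreover have "\<forall>\<^sub>F n in sequentially. \<phi> (x n) \<in> \<phi> ` sector a' b'"
        using eventually_in_sector[OF t(1,2) x(1) x(2)[unfolded t(3)]]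
        by (rule eventually_mono) auto
      then have "w \<in> closure (\<phi> ` sector a' b')"
        using x(3) by (rule eventually_in_closure)
      ultimately show "w = q" using trace by auto
    qed
    then have "((\<lambda>z. \<phi> z - q) \<longlongrightarrow> q - q) (at u within ball 0 1)"
      by (intro tendsto_intros)
    then show "((\<lambda>z. \<phi> z - q) \<longlongrightarrow> 0) (at u within ball 0 1)"
      by simp
  qed auto
  have "cis m \<in> closure (ball 0 1)" by simp
  moreover have "d / 8 > 0" using d by simp
  ultimately obtain v where "v \<in> ball 0 1" "dist v (cis m) < d / 8"
    unfolding closure_approachable by blast
  then show False
    using const[of v] q by (auto simp: frontier_\<Omega>)
qed

lemma rays_arc_loop:
  assumes ab: "a < b" "b < a + 2 * pi" and "lands a (pathstart g)" "lands b (pathfinish g)"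
    and g: "arc g" "path_image g \<subseteq> frontier \<Omega>"
  obtains c where "simple_path c" "pathfinish c = pathstart c"
    "path_image c = \<phi> ` (radius a \<union> radius b) \<union> path_image g"
proof
  let ?p = "pathstart g" and ?q = "pathfinish g"
  define c where "c = (ray a ?p +++ g) +++ reversepath (ray b ?q)"
  have ends: "?p \<in> path_image g" "?q \<in> path_image g" by auto
  have disj: "\<phi> ` radius t \<inter> path_image g = {}" for t
    using radius_subset[of t] g(2) by (auto simp: frontier_\<Omega>)
  have 0: "\<phi> ` radius a \<inter> \<phi> ` radius b = {\<phi> 0}"
    using inj_on_image_Int[OF injective radius_subset radius_subset, of a b] radius_Int_radius[OF ab]
    by simp
  have arc1: "arc (ray a ?p +++ g)"
    using disj[of a] by (intro arc_join arc_ray g assms) (auto simp: path_image_ray)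
  have img1: "path_image (ray a ?p +++ g) = \<phi> ` radius a \<union> path_image g"
    using ends by (subst path_image_join) (auto simp: path_image_ray)
  show "simple_path c"
    unfolding c_def
  proof (rule simple_path_join_loop[OF arc1])
    show "arc (reversepath (ray b ?q))"
      using arc_ray[OF assms(4)] by (rule arc_reversepath)
    have "?p \<notin> \<phi> ` radius b"
      using ends disj[of b] by blast
    then show "path_image (ray a ?p +++ g) \<inter> path_image (reversepath (ray b ?q)) \<subseteq>
        {pathstart (ray a ?p +++ g), pathstart (reversepath (ray b ?q))}"
      unfolding img1 path_image_reversepath path_image_ray
      using 0 disj[of a] disj[of b] ends by auto
  qed simp_all
  show "pathfinish c = pathstart c" by (simp add: c_def)
  show "path_image c = \<phi> ` (radius a \<union> radius b) \<union> path_image g"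
    unfolding c_def using ends by (subst path_image_join) (auto simp: img1 path_image_ray)
qed

lemma rays_arc_trace:
  assumes "a < b" "b < a + 2 * pi" and "lands a (pathstart g)" "lands b (pathfinish g)"
    and "arc g" "path_image g \<subseteq> frontier \<Omega>"
  shows "closure (\<phi> ` sector a b) \<inter> frontier \<Omega> \<subseteq> path_image g \<or>
    closure (\<phi> ` sector b (a + 2 * pi)) \<inter> frontier \<Omega> \<subseteq> path_image g"
proof -
  obtain c where c: "simple_path c" "pathfinish c = pathstart c"
    "path_image c = \<phi> ` (radius a \<union> radius b) \<union> path_image g"
    using rays_arc_loop[OF assms] by blast
  show ?thesis
    using loop_inside[OF c assms(6,1,2)] loop_trace[OF c] sector_subset by metis
qed

text \<open>A ray that lands on the arc splits the sector as it splits the arc. By \<open>rays_arc_trace\<close>, the frontier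
  points reached from one of the two sectors bounded by the rays \<open>a\<close> and \<open>c\<close> lie on the sub-arc between
  \<open>h 0\<close> and \<open>h s\<close>. That sector does not contain the ray \<open>b\<close>, because \<open>h 1\<close> is not on this
  sub-arc; the other half is symmetric. This is what makes landing points monotone in the angle.\<close>

lemma split_trace:
  assumes ab: "a < b" "b < a + 2 * pi" and h: "arc h" "path_image h \<subseteq> frontier \<Omega>"
    and la: "lands a (h 0)" and lb: "lands b (h 1)"
    and c: "a < c" "c < b" "s \<in> {0..1}" "lands c (h s)"
  shows "closure (\<phi> ` sector a c) \<inter> frontier \<Omega> \<subseteq> h ` {0..s}"
    and "closure (\<phi> ` sector c b) \<inter> frontier \<Omega> \<subseteq> h ` {s..1}"
proof -
  have inj: "x = y" if "h x = h y" "x \<in> {0..1}" "y \<in> {0..1}" for x y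
    using h(1) that by (auto simp: arc_def inj_on_def)
  have "s \<noteq> 0" using rays_landing_same_point[of a c "h 0"] la c ab by auto
  have "s \<noteq> 1" using rays_landing_same_point[of c b "h 1"] lb c ab by auto
  have sub: "h ` {0..s} \<subseteq> frontier \<Omega>" "h ` {s..1} \<subseteq> frontier \<Omega>"
    using h(2) c(3) by (auto simp: path_image_def image_subset_iff)
  have img: "path_image (subpath 0 s h) = h ` {0..s}" "path_image (subpath s 1 h) = h ` {s..1}"
    using c(3) by (simp_all add: path_image_subpath)
  have arcs: "arc (subpath 0 s h)" "arc (subpath s 1 h)"
    using arc_subpath_arc[OF h(1)] c(3) \<open>s \<noteq> 0\<close> \<open>s \<noteq> 1\<close> by auto
  have "\<not> closure (\<phi> ` sector c (a + 2 * pi)) \<inter> frontier \<Omega> \<subseteq> h ` {0..s}"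
  proof
    assume "closure (\<phi> ` sector c (a + 2 * pi)) \<inter> frontier \<Omega> \<subseteq> h ` {0..s}"
    moreover have "h 1 \<in> closure (\<phi> ` sector c (a + 2 * pi))"
      by (rule lands_in_closure_sector[OF lb]) (use c ab in auto)
    ultimately have "h 1 \<in> h ` {0..s}"
      using lands_in_frontier[OF lb] by blast
    then obtain y where y: "y \<in> {0..s}" "h 1 = h y" by blast
    then have "1 = y" by (intro inj) (use c(3) in auto)
    then show False
      using y c(3) \<open>s \<noteq> 1\<close> by auto
  qed
  then show "closure (\<phi> ` sector a c) \<inter> frontier \<Omega> \<subseteq> h ` {0..s}"
    using rays_arc_trace[of a c "subpath 0 s h"] img arcs sub la c ab by auto
  have "\<not> closure (\<phi> ` sector b (c + 2 * pi)) \<inter> frontier \<Omega> \<subseteq> h ` {s..1}"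
  proof
    assume "closure (\<phi> ` sector b (c + 2 * pi)) \<inter> frontier \<Omega> \<subseteq> h ` {s..1}"
    moreover have "h 0 \<in> closure (\<phi> ` sector b (c + 2 * pi))"
      by (rule lands_in_closure_sector[of "a + 2 * pi"]) (use la c ab in auto)
    ultimately have "h 0 \<in> h ` {s..1}"
      using lands_in_frontier[OF la] by blast
    then obtain y where y: "y \<in> {s..1}" "h 0 = h y" by blast
    then have "0 = y" by (intro inj) (use c(3) in auto)
    then show False
      using y c(3) \<open>s \<noteq> 0\<close> by auto
  qed
  then show "closure (\<phi> ` sector c b) \<inter> frontier \<Omega> \<subseteq> h ` {s..1}"
    using rays_arc_trace[of c b "subpath s 1 h"] img arcs sub lb c ab by auto
qed

end

section \<open>Existence of boundary limits\<close>

context disk_map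
begin

text \<open>This is the extension theorem of Caratheodory for the part \<open>\<phi> ` sector a b\<close> of \<open>\<Omega>\<close>, which is the inside
  of a Jordan curve. Landing points of rays on the two sides of \<open>\<tau>\<close> are separated on the arc; let
  \<open>h \<sigma>\<close> and \<open>h \<upsilon>\<close> be the limits of these landing points from the two sides. Every
  cluster value of \<open>\<phi>\<close> at \<open>cis \<tau>\<close> lies between them, so it is enough to exclude a gap \<open>\<sigma> < \<upsilon>\<close>.

  In a gap, the only boundary point of the disk that can correspond to \<open>h y\<close> with \<open>\<sigma> < y < \<upsilon>\<close> is
  \<open>cis \<tau>\<close>. Hence the inverse \<open>\<psi>\<close> has the constant boundary value \<open>cis \<tau>\<close> along the gap, and
  \<open>boundary_uniqueness\<close>, now applied on the image side, makes \<open>\<psi>\<close> constant near the gap. Points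
  outside the Jordan domain and close to the gap exist because the Jordan curve is also the frontier
  of its outside.\<close>

lemma boundary_limit:
  assumes ab: "a < b" "b < a + 2 * pi" and h: "arc h" "path_image h \<subseteq> frontier \<Omega>"
    and la: "lands a (h 0)" and lb: "lands b (h 1)"
    and c: "simple_path c" "pathfinish c = pathstart c"
      "path_image c = \<phi> ` (radius a \<union> radius b) \<union> path_image h"
      "inside (path_image c) = \<phi> ` sector a b"
    and dense: "\<And>s t. s < t \<Longrightarrow> \<exists>u q. s < u \<and> u < t \<and> lands u q"
    and \<tau>: "a < \<tau>" "\<tau> < b"
  shows "\<exists>v. (\<phi> \<longlongrightarrow> v) (at (cis \<tau>) within ball 0 1)"
proof -
  have himg: "path_image h = h ` {0..1}" by (simp add: path_image_def)
  have inj: "x = y" if "h x = h y" "x \<in> {0..1}" "y \<in> {0..1}" for x y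
    using h(1) that by (auto simp: arc_def inj_on_def)
  have trace: "closure (\<phi> ` sector a b) \<inter> frontier \<Omega> \<subseteq> h ` {0..1}"
    using loop_trace[OF c sector_subset] himg by simp
  have land_param: "\<exists>s\<in>{0..1}. lands t (h s)" if t: "lands t q" "a < t" "t < b" for t q
    using lands_in_closure_sector[OF t] lands_in_frontier[OF t(1)] trace t(1) by blast
  note split = split_trace[OF ab h la lb]
  define L where "L = {s \<in> {0..1}. \<exists>t. a < t \<and> t < \<tau> \<and> lands t (h s)}"
  define U where "U = {s \<in> {0..1}. \<exists>t. \<tau> < t \<and> t < b \<and> lands t (h s)}"
  have "L \<noteq> {}"
    using dense[OF \<tau>(1)] land_param \<tau> unfolding L_def by fastforce
  have "U \<noteq> {}"
    using dense[OF \<tau>(2)] land_param \<tau> unfolding U_def by fastforce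
  have LU: "s \<le> s'" if s: "s \<in> L" and s': "s' \<in> U" for s s'
  proof -
    obtain t where t: "a < t" "t < \<tau>" "lands t (h s)" "s \<in> {0..1}"
      using s by (auto simp: L_def)
    obtain t' where t': "\<tau> < t'" "t' < b" "lands t' (h s')" "s' \<in> {0..1}"
      using s' by (auto simp: U_def)
    have "h s \<in> h ` {0..s'}"
      using split(1)[of t' s'] lands_in_closure_sector[OF t(3), of a t'] lands_in_frontier[OF t(3)]
        t t' \<tau> by auto
    then obtain y where y: "y \<in> {0..s'}" "h s = h y" by blast
    then have "s = y" by (intro inj) (use t t' in auto)
    then show ?thesis using y by simp
  qed
  define \<sigma> where "\<sigma> = Sup L"
  define \<upsilon> where "\<upsilon> = Inf U"
  have bdd: "bdd_above L" "bdd_below U"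
    by (auto simp: L_def U_def intro!: bdd_aboveI[of _ 1] bdd_belowI[of _ 0])
  have \<sigma>: "s \<le> \<sigma>" if "s \<in> L" for s unfolding \<sigma>_def by (rule cSup_upper[OF that bdd(1)])
  have \<upsilon>: "\<upsilon> \<le> s" if "s \<in> U" for s unfolding \<upsilon>_def by (rule cInf_lower[OF that bdd(2)])
  have "\<sigma> \<le> \<upsilon>"
    unfolding \<sigma>_def \<upsilon>_def
    by (intro cSup_least[OF \<open>L \<noteq> {}\<close>] cInf_greatest[OF \<open>U \<noteq> {}\<close>] LU)
  have range: "0 \<le> \<sigma>" "\<upsilon> \<le> 1"
    using \<open>L \<noteq> {}\<close> \<open>U \<noteq> {}\<close> \<sigma> \<upsilon> unfolding L_def U_def
    by (auto intro: order_trans)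
  have "\<sigma> = \<upsilon>"
  proof (rule ccontr)
    assume "\<sigma> \<noteq> \<upsilon>"
    then have "\<sigma> < \<upsilon>" using \<open>\<sigma> \<le> \<upsilon>\<close> by simp
    define V where "V = inside (path_image c)"
    define m where "m = (\<sigma> + \<upsilon>) / 2"
    have m: "\<sigma> < m" "m < \<upsilon>" using \<open>\<sigma> < \<upsilon>\<close> by (simp_all add: m_def)
    have m01: "m \<in> {0..1}" using m range by simp
    have hm: "h m \<in> frontier \<Omega>" "h m \<in> path_image c"
      using h(2) himg c(3) m01 by auto
    have V: "V \<noteq> {}" "open V" "connected V" "bounded V" "frontier V = path_image c"
      "closure (- closure V) = closure (outside (path_image c))"
      "frontier (outside (path_image c)) = path_image c"
      using Jordan_inside_outside[OF c(1,2)] unfolding V_def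
      by (auto simp: closure_Un_frontier outside_inside Un_commute)
    have VS: "V = \<phi> ` sector a b" using c(4) by (simp add: V_def)
    have V\<Omega>: "V \<subseteq> \<Omega>" using VS sector_subset by blast
    \<comment> \<open>\<open>K\<close> is the part of the Jordan curve outside the gap, so a disk that avoids \<open>K\<close> meets the curve
      only in the gap.\<close>
    define K where "K = path_image (ray a (h 0)) \<union> path_image (ray b (h 1)) \<union> h ` {0..\<sigma>} \<union> h ` {\<upsilon>..1}"
    have cont_h: "continuous_on {0..1} h" using h(1) by (simp add: arc_def path_def)
    have "closed K"
      unfolding K_def using arc_imp_path[OF arc_ray[OF la]] arc_imp_path[OF arc_ray[OF lb]] range \<open>\<sigma> \<le> \<upsilon>\<close>
      by (intro closed_Un closed_path_image compact_imp_closed compact_continuous_image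
          continuous_on_subset[OF cont_h]) auto
    moreover have "h m \<notin> K"
    proof
      assume "h m \<in> K"
      moreover have "h m \<notin> \<phi> ` radius t" for t
        using hm(1) radius_subset[of t] by (auto simp: frontier_\<Omega>)
      ultimately obtain y where y: "h m = h y" "y \<in> {0..\<sigma>} \<union> {\<upsilon>..1}"
        unfolding K_def path_image_ray using range by force
      then have "m = y" by (intro inj) (use m01 range \<open>\<sigma> \<le> \<upsilon>\<close> in auto)
      then show False using y m by auto
    qed
    ultimately obtain d where d: "d > 0" "\<And>u. dist u (h m) < d \<Longrightarrow> u \<notin> K"
      using open_Compl[of K] unfolding open_dist by (metis ComplD ComplI)
    have const: "\<psi> v - cis \<tau> = 0" if v: "v \<in> V" "dist v (h m) < d / 8" for v
    proof (rule boundary_uniqueness[OF V(2-4) _ _ _ d(1) _ v])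
      have "\<psi> holomorphic_on V" by (rule holomorphic_on_subset[OF holomorphic_\<psi> V\<Omega>])
      then show "(\<lambda>w. \<psi> w - cis \<tau>) holomorphic_on V" by (intro holomorphic_intros)
      have \<psi>V: "\<psi> ` V \<subseteq> ball 0 1" using V\<Omega> by auto
      then have b\<psi>: "bounded (\<psi> ` V)" using bounded_subset bounded_ball by blast
      then have "bounded ((\<lambda>z. z - cis \<tau>) ` \<psi> ` V)"
        using bounded_translation[of "\<psi> ` V" "- cis \<tau>"] by (simp add: add.commute)
      then show "bounded ((\<lambda>w. \<psi> w - cis \<tau>) ` V)"
        by (simp add: image_image)
      show "h m \<in> closure (- closure V)"
        unfolding V(6) using V(7) hm(2) unfolding frontier_def by blast
      fix u assume u: "u \<in> frontier V" "dist u (h m) < d"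
      then have "u \<notin> K" by (intro d(2))
      moreover have "u \<in> \<phi> ` (radius a \<union> radius b) \<union> h ` {0..1}"
        using u(1) V(5) c(3) himg by simp
      ultimately obtain y where y: "u = h y" "\<sigma> < y" "y < \<upsilon>" "y \<in> {0..1}"
        unfolding K_def path_image_ray by force
      have u\<Omega>: "u \<in> frontier \<Omega>" using y(1,4) himg h(2) by auto
      have "(\<psi> \<longlongrightarrow> cis \<tau>) (at u within V)"
      proof (rule tendsto_unique_cluster_value[OF b\<psi>])
        fix w \<xi> assume w: "\<And>n. w n \<in> V" "w \<longlonglongrightarrow> u" and \<xi>: "(\<lambda>n. \<psi> (w n)) \<longlonglongrightarrow> \<xi>"
        have w_sector: "\<psi> (w n) \<in> sector a b" for n
        proof -
          obtain z where z: "w n = \<phi> z" "z \<in> sector a b" using w(1)[of n] VS by auto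
          then show ?thesis using \<psi>_\<phi>[OF subsetD[OF sector_subset z(2)]] by simp
        qed
        have "\<exists>t. a < t \<and> t < b \<and> \<psi> (w n) = of_real (norm (\<psi> (w n))) * cis t" for n
        proof -
          obtain r t where "0 < r" "a < t" "t < b" "\<psi> (w n) = of_real r * cis t"
            using w_sector[of n] by (auto simp: sector_def)
          moreover from this have "norm (\<psi> (w n)) = r" by (simp add: norm_mult)
          ultimately show ?thesis by metis
        qed
        then obtain t where t: "\<And>n. a < t n" "\<And>n. t n < b"
            "\<And>n. \<psi> (w n) = of_real (norm (\<psi> (w n))) * cis (t n)"
          by metis
        have w\<phi>: "\<phi> (\<psi> (w n)) = w n" "\<psi> (w n) \<in> ball 0 1" for n
          using w(1)[of n] V\<Omega> by auto
        have "norm \<xi> = 1"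
          by (rule norm_limit_eq_1[OF w\<phi>(2) \<xi>, of u]) (use w(2) w\<phi>(1) u\<Omega> in \<open>auto simp: frontier_\<Omega>\<close>)
        have "bounded (range t)"
          by (rule bounded_subset[of "{a..b}"]) (use t in \<open>auto simp: less_imp_le\<close>)
        then obtain t' k where k: "strict_mono k" "(t \<circ> k) \<longlonglongrightarrow> t'"
          using bounded_imp_convergent_subsequence by blast
        have "a \<le> t'" "t' \<le> b"
          using LIMSEQ_le_const[OF k(2), of a] LIMSEQ_le_const2[OF k(2), of b] t
          by (auto simp: less_imp_le)
        have wk: "(w \<circ> k) \<longlonglongrightarrow> u" by (rule LIMSEQ_subseq_LIMSEQ[OF w(2) k(1)])
        have psik: "(\<lambda>n. \<psi> (w (k n))) \<longlonglongrightarrow> \<xi>"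
          using LIMSEQ_subseq_LIMSEQ[OF \<xi> k(1)] by (simp add: o_def)
        have "(\<lambda>n. of_real (norm (\<psi> (w (k n)))) * cis (t (k n))) \<longlonglongrightarrow> of_real (norm \<xi>) * cis t'"
          using k(2) unfolding o_def by (intro tendsto_intros psik)
        then have "(\<lambda>n. \<psi> (w (k n))) \<longlonglongrightarrow> cis t'"
          using \<open>norm \<xi> = 1\<close> by (simp flip: t(3))
        then have \<xi>t: "\<xi> = cis t'" using psik LIMSEQ_unique by blast
        have in_sector: "u \<in> closure (\<phi> ` sector s s')"
          if "\<forall>\<^sub>F n in sequentially. s < t (k n) \<and> t (k n) < s'" for s s'
        proof (rule eventually_in_closure[OF _ wk])
          have "\<psi> (w (k n)) \<noteq> 0" for n
            using w_sector[of "k n"] by (auto simp: sector_def)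
          then have pos: "0 < norm (\<psi> (w (k n)))" "norm (\<psi> (w (k n))) < 1" for n
            using w\<phi>(2)[of "k n"] by auto
          show "\<forall>\<^sub>F n in sequentially. (w \<circ> k) n \<in> \<phi> ` sector s s'"
            using that
          proof eventually_elim
            case (elim n)
            have "\<psi> (w (k n)) \<in> sector s s'"
              unfolding sector_def using pos[of n] elim t(3)[of "k n"] by blast
            then show ?case using w\<phi>(1)[of "k n"] by (metis comp_apply image_eqI)
          qed
        qed
        \<comment> \<open>If the angles clustered before \<open>\<tau>\<close>, a landing ray \<open>e\<close> in between would confine \<open>u = h y\<close> to the
          part of the arc up to \<open>h \<sigma>\<close>.\<close>
        have "\<not> t' < \<tau>"
        proof
          assume "t' < \<tau>"
          then obtain e q where e: "max a t' < e" "e < \<tau>" "lands e q"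
            using dense[of "max a t'" \<tau>] \<tau> by auto
          then obtain s where s: "s \<in> {0..1}" "lands e (h s)" using land_param \<tau> by fastforce
          have "\<forall>\<^sub>F n in sequentially. (t \<circ> k) n < e"
            by (rule order_tendstoD(2)[OF k(2)]) (use e in simp)
          then have "u \<in> closure (\<phi> ` sector a e)"
            by (intro in_sector) (use t(1) in simp)
          then have "u \<in> h ` {0..s}" using split(1)[of e s] e s \<tau> u\<Omega> by auto
          then obtain x where x: "x \<in> {0..s}" "h y = h x" using y(1) by (metis imageE)
          then have "y = x" by (intro inj) (use y s in auto)
          moreover have "s \<in> L" using s e by (auto simp: L_def)
          ultimately show False using x y \<sigma>[of s] by auto
        qed
        moreover have "\<not> \<tau> < t'"
        proof
          assume "\<tau> < t'"
          then obtain e q where e: "\<tau> < e" "e < min b t'" "lands e q"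
            using dense[of \<tau> "min b t'"] \<tau> by auto
          then obtain s where s: "s \<in> {0..1}" "lands e (h s)" using land_param \<tau> by fastforce
          have "\<forall>\<^sub>F n in sequentially. e < (t \<circ> k) n"
            by (rule order_tendstoD(1)[OF k(2)]) (use e in simp)
          then have "u \<in> closure (\<phi> ` sector e b)"
            by (intro in_sector) (use t(2) in simp)
          then have "u \<in> h ` {s..1}" using split(2)[of e s] e s \<tau> u\<Omega> by auto
          then obtain x where x: "x \<in> {s..1}" "h y = h x" using y(1) by (metis imageE)
          then have "y = x" by (intro inj) (use y s in auto)
          moreover have "s \<in> U" using s e by (auto simp: U_def)
          ultimately show False using x y \<upsilon>[of s] by auto
        qed
        ultimately show "\<xi> = cis \<tau>" using \<xi>t by simp
      qed
      then have "((\<lambda>w. \<psi> w - cis \<tau>) \<longlongrightarrow> cis \<tau> - cis \<tau>) (at u within V)"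
        by (intro tendsto_intros)
      then show "((\<lambda>w. \<psi> w - cis \<tau>) \<longlongrightarrow> 0) (at u within V)" by simp
    qed
    have "h m \<in> closure V" using V(5) hm(2) unfolding frontier_def by blast
    moreover have "d / 8 > 0" using d by simp
    ultimately obtain v where v: "v \<in> V" "dist v (h m) < d / 8"
      unfolding closure_approachable by blast
    then have "\<psi> v = cis \<tau>" using const by simp
    moreover have "\<psi> v \<in> ball 0 1" using v(1) V\<Omega> by auto
    ultimately show False by simp
  qed
  have "(\<phi> \<longlongrightarrow> h \<sigma>) (at (cis \<tau>) within ball 0 1)"
  proof (rule tendsto_unique_cluster_value[OF bounded_image])
    fix x u assume x: "\<And>n. x n \<in> ball 0 1" "x \<longlonglongrightarrow> cis \<tau>" "(\<lambda>n. \<phi> (x n)) \<longlonglongrightarrow> u"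
    have u\<Omega>: "u \<in> frontier \<Omega>" by (rule limit_in_frontier[OF x(1,2) _ x(3)]) simp
    have in_sector: "u \<in> closure (\<phi> ` sector s s')" if "s < \<tau>" "\<tau> < s'" for s s'
      using eventually_in_sector[OF that x(1,2)]
      by (intro eventually_in_closure[OF _ x(3)]) (auto elim: eventually_mono)
    then obtain y where y: "u = h y" "y \<in> {0..1}" using trace u\<Omega> \<tau> by blast
    have "s \<le> y" if "s \<in> L" for s
    proof -
      obtain t where t: "a < t" "t < \<tau>" "lands t (h s)" "s \<in> {0..1}"
        using \<open>s \<in> L\<close> by (auto simp: L_def)
      then obtain z where "h y = h z" "z \<in> {s..1}"
        using split(2)[of t s] in_sector[of t b] \<tau> u\<Omega> y by auto
      then show ?thesis using inj[of y z] y t by auto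
    qed
    then have "\<sigma> \<le> y" unfolding \<sigma>_def by (rule cSup_least[OF \<open>L \<noteq> {}\<close>])
    have "y \<le> s" if "s \<in> U" for s
    proof -
      obtain t where t: "\<tau> < t" "t < b" "lands t (h s)" "s \<in> {0..1}"
        using \<open>s \<in> U\<close> by (auto simp: U_def)
      then obtain z where "h y = h z" "z \<in> {0..s}"
        using split(1)[of t s] in_sector[of a t] \<tau> u\<Omega> y by auto
      then show ?thesis using inj[of y z] y t by auto
    qed
    then have "y \<le> \<upsilon>" unfolding \<upsilon>_def by (rule cInf_greatest[OF \<open>U \<noteq> {}\<close>])
    with \<open>\<sigma> \<le> y\<close> \<open>\<sigma> = \<upsilon>\<close> show "u = h \<sigma>" using y by simp
  qed
  then show ?thesis by blast
qed

lemma tendsto_imp_lands: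
  assumes "(\<phi> \<longlongrightarrow> v) (at (cis t) within ball 0 1)"
  shows "lands t v"
  unfolding lands_def
proof (rule filterlim_compose[OF assms])
  have "((\<lambda>r. of_real r * cis t) \<longlongrightarrow> of_real 1 * cis t) (at_left 1)"
    by (intro tendsto_intros)
  moreover have "\<forall>\<^sub>F r in at_left (1::real). r \<in> {0<..<1}"
    by (rule eventually_at_leftI[of 0]) auto
  then have "\<forall>\<^sub>F r in at_left (1::real). of_real r * cis t \<in> ball 0 1 \<and> of_real r * cis t \<noteq> cis t"
    by eventually_elim (auto simp: norm_mult)
  ultimately show "filterlim (\<lambda>r. of_real r * cis t) (at (cis t) within ball 0 1) (at_left 1)"
    by (simp add: filterlim_at)
qed

text \<open>The boundary values form a continuous map of the circle onto the frontier, and it is injective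
  because two rays cannot land at the same point.\<close>

lemma frontier_homeomorphic_circle:
  assumes lim: "\<And>t. \<exists>v. (\<phi> \<longlongrightarrow> v) (at (cis t) within ball 0 1)"
  shows "frontier \<Omega> homeomorphic sphere (0::complex) 1"
proof -
  have cis_Arg1: "cis (Arg z) = z" if "z \<in> sphere 0 1" for z
  proof -
    have "z \<noteq> 0" using that by auto
    then show ?thesis using that by (simp add: cis_Arg sgn_eq)
  qed
  have lim': "\<exists>v. (\<phi> \<longlongrightarrow> v) (at z within ball 0 1)" if "z \<in> sphere 0 1" for z
    using lim[of "Arg z"] cis_Arg1[OF that] by simp
  define b where "b z = Lim (at z within ball 0 1) \<phi>" for z
  have nontriv: "at z within ball 0 1 \<noteq> bot" if "z \<in> sphere 0 1" for z :: complex
  proof -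
    have "z \<in> closure (ball 0 1)" "z \<notin> ball 0 1" using that by auto
    then show ?thesis by (simp add: closure_def trivial_limit_within del: closure_ball)
  qed
  have b: "(\<phi> \<longlongrightarrow> b z) (at z within ball 0 1)" if "z \<in> sphere 0 1" for z
    using lim'[OF that] nontriv[OF that] unfolding b_def by (metis tendsto_Lim)
  have b_frontier: "b z \<in> frontier \<Omega>" if z: "z \<in> sphere 0 1" for z
  proof -
    have "lands (Arg z) (b z)"
      by (rule tendsto_imp_lands) (use b[OF z] cis_Arg1[OF z] in simp)
    then show ?thesis by (rule lands_in_frontier)
  qed
  have inj: "inj_on b (sphere 0 1)"
  proof (rule inj_onI, rule ccontr)
    have wlog: False if zw: "z \<in> sphere 0 1" "w \<in> sphere 0 1" "b z = b w" "Arg z < Arg w" for z w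
    proof (rule rays_landing_same_point[OF zw(4)])
      show "Arg w < Arg z + 2 * pi" using Arg_bounded[of z] Arg_bounded[of w] by simp
      have "lands (Arg z) (b z)"
        by (rule tendsto_imp_lands) (use b[OF zw(1)] cis_Arg1[OF zw(1)] in simp)
      then show "lands (Arg z) (b z)" .
      have "lands (Arg w) (b w)"
        by (rule tendsto_imp_lands) (use b[OF zw(2)] cis_Arg1[OF zw(2)] in simp)
      then show "lands (Arg w) (b z)" using zw by simp
    qed
    fix z w assume zw: "z \<in> sphere 0 1" "w \<in> sphere 0 1" "b z = b w" "z \<noteq> w"
    have "Arg z \<noteq> Arg w"
      using zw cis_Arg1[of z] cis_Arg1[of w] by metis
    then show False using wlog[of z w] wlog[of w z] zw by fastforce
  qed
  have surj: "b ` sphere 0 1 = frontier \<Omega>"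
  proof
    show "b ` sphere 0 1 \<subseteq> frontier \<Omega>" using b_frontier by blast
    show "frontier \<Omega> \<subseteq> b ` sphere 0 1"
    proof
      fix u assume u: "u \<in> frontier \<Omega>"
      then have "u \<in> closure \<Omega>" by (simp add: frontier_def)
      then obtain w where w: "\<And>n. w n \<in> \<Omega>" "w \<longlonglongrightarrow> u"
        using closure_sequential by metis
      have w\<phi>: "\<phi> (\<psi> (w n)) = w n" "\<psi> (w n) \<in> ball 0 1" for n
        using w(1)[of n] by auto
      have "bounded (range (\<lambda>n. \<psi> (w n)))"
        by (rule bounded_subset[OF bounded_ball]) (use w\<phi>(2) in blast)
      then obtain \<xi> k where k: "strict_mono k" "((\<lambda>n. \<psi> (w n)) \<circ> k) \<longlonglongrightarrow> \<xi>"
        using bounded_imp_convergent_subsequence by blast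
      have lim: "(\<lambda>n. \<phi> (((\<lambda>n. \<psi> (w n)) \<circ> k) n)) \<longlonglongrightarrow> u"
        using LIMSEQ_subseq_LIMSEQ[OF w(2) k(1)] w\<phi>(1) by (simp add: o_def)
      have "norm \<xi> = 1"
        by (rule norm_limit_eq_1[OF _ k(2) lim]) (use w\<phi>(2) u in \<open>auto simp: frontier_\<Omega>\<close>)
      then have \<xi>: "\<xi> \<in> sphere 0 1" by simp
      have "\<psi> (w (k n)) \<noteq> \<xi>" for n
        using w\<phi>(2)[of "k n"] \<open>norm \<xi> = 1\<close> by auto
      then have "filterlim ((\<lambda>n. \<psi> (w n)) \<circ> k) (at \<xi> within ball 0 1) sequentially"
        using k(2) w\<phi>(2) by (auto simp: filterlim_at)
      from filterlim_compose[OF b[OF \<xi>] this] have "u = b \<xi>"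
        using lim LIMSEQ_unique by blast
      then show "u \<in> b ` sphere 0 1" using \<xi> by blast
    qed
  qed
  have cont: "continuous_on (sphere 0 1) b"
    unfolding continuous_on_iff
  proof (intro ballI allI impI)
    fix z :: complex and e :: real assume z: "z \<in> sphere 0 1" and "e > 0"
    then have "\<forall>\<^sub>F w in at z within ball 0 1. dist (\<phi> w) (b z) < e / 2"
      using b[OF z] by (intro tendstoD) auto
    then obtain d where d: "d > 0" "\<And>w. \<lbrakk>w \<in> ball 0 1; dist w z < d\<rbrakk> \<Longrightarrow> dist (\<phi> w) (b z) < e / 2"
      unfolding eventually_at using z
      by (metis dist_self less_irrefl mem_ball mem_sphere)
    have "dist (b y) (b z) < e" if y: "y \<in> sphere 0 1" "dist y z < d" for y
    proof -
      have "\<forall>\<^sub>F w in at y within ball 0 1. w \<in> ball 0 1"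
        by (simp add: eventually_at_topological) auto
      moreover have "\<forall>\<^sub>F w in at y within ball 0 1. w \<in> ball z d"
        using y(2) by (intro topological_tendstoD[OF tendsto_ident_at]) (auto simp: dist_commute)
      ultimately have "\<forall>\<^sub>F w in at y within ball 0 1. dist (\<phi> w) (b z) \<le> e / 2"
        by eventually_elim (use d(2) in \<open>auto simp: dist_commute less_imp_le\<close>)
      then have "dist (b y) (b z) \<le> e / 2"
        by (intro tendsto_upperbound[OF tendsto_dist[OF b[OF y(1)] tendsto_const] _ nontriv[OF y(1)]])
      then show ?thesis using \<open>e > 0\<close> by simp
    qed
    then show "\<exists>d>0. \<forall>y\<in>sphere 0 1. dist y z < d \<longrightarrow> dist (b y) (b z) < e"
      using d(1) by blast
  qed
  have "sphere (0::complex) 1 homeomorphic frontier \<Omega>"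
    by (rule homeomorphic_compact[OF compact_sphere cont surj inj])
  then show ?thesis by (rule homeomorphic_sym[THEN iffD1])
qed

end

section \<open>Spreading limits by an irrational rotation\<close>

lemma irrational_angles_dense:
  fixes \<theta> :: real
  assumes "\<theta> \<notin> \<rat>" "s < t"
  obtains n :: nat and k :: int where "s < a + 2 * pi * (n * \<theta> + k)" "a + 2 * pi * (n * \<theta> + k) < t"
proof -
  \<comment> \<open>The multiples of \<open>\<theta>\<close> are steered to the midpoint of the interval, measured in turns from \<open>a\<close>.\<close>
  define x where "x = ((s + t) / 2 - a) / (2 * pi)"
  have "(t - s) / (4 * pi) > 0" using assms by simp
  then obtain n where n: "\<bar>frac (real n * \<theta>) - frac x\<bar> < (t - s) / (4 * pi)"
    using Kronecker_approx_1_explicit[OF assms(1), of "frac x" "(t - s) / (4 * pi)"]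
    by (metis frac_ge_0 frac_lt_1 less_imp_le)
  define k where "k = \<lfloor>x\<rfloor> - \<lfloor>real n * \<theta>\<rfloor>"
  have "\<bar>n * \<theta> + k - x\<bar> < (t - s) / (4 * pi)"
    using n by (simp add: frac_def k_def algebra_simps)
  then have "2 * pi * \<bar>n * \<theta> + k - x\<bar> < 2 * pi * ((t - s) / (4 * pi))"
    by (intro mult_strict_left_mono) auto
  then have "\<bar>2 * pi * (n * \<theta> + k - x)\<bar> < (t - s) / 2"
    by (simp add: abs_mult)
  moreover have "2 * pi * x = (s + t) / 2 - a" by (simp add: x_def)
  then have "2 * pi * (n * \<theta> + k - x) = a + 2 * pi * (n * \<theta> + k) - (s + t) / 2"
    unfolding right_diff_distrib by linarith
  ultimately have "\<bar>a + 2 * pi * (n * \<theta> + k) - (s + t) / 2\<bar> < (t - s) / 2"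
    by simp
  then have "s < a + 2 * pi * (n * \<theta> + k)" "a + 2 * pi * (n * \<theta> + k) < t"
    by (auto simp: abs_less_iff field_simps)
  then show ?thesis by (rule that)
qed

lemma cis_shift_int: "cis (a + 2 * pi * (x + of_int k)) = cis (a + 2 * pi * x)"
proof -
  have "cis (2 * pi * of_int k) = 1" by (simp add: complex_eq_iff)
  moreover have "cis (a + 2 * pi * (x + of_int k)) = cis (a + 2 * pi * x) * cis (2 * pi * of_int k)"
    by (simp add: cis_mult algebra_simps)
  ultimately show ?thesis by simp
qed

locale rotation_disk = disk_map +
  fixes f :: "complex \<Rightarrow> complex" and \<theta> :: real
  assumes continuous_f: "continuous_on UNIV f"
    and irrational: "\<theta> \<notin> \<rat>"
    and conjugacy: "\<And>z. z \<in> ball 0 1 \<Longrightarrow> f (\<phi> z) = \<phi> (cis (2 * pi * \<theta>) * z)"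
begin

lemma isCont_f: "isCont f z"
  using continuous_f by (simp add: continuous_on_eq_continuous_at)

lemma lands_rotate:
  assumes "lands t q"
  shows "lands (t + 2 * pi * \<theta>) (f q)"
proof -
  have "((\<lambda>r. f (\<phi> (of_real r * cis t))) \<longlongrightarrow> f q) (at_left 1)"
    using assms unfolding lands_def by (rule isCont_tendsto_compose[OF isCont_f])
  moreover have "\<forall>\<^sub>F r in at_left (1::real). r \<in> {0<..<1}"
    by (rule eventually_at_leftI[of 0]) auto
  then have "\<forall>\<^sub>F r in at_left (1::real). f (\<phi> (of_real r * cis t)) = \<phi> (of_real r * cis (t + 2 * pi * \<theta>))"
  proof eventually_elim
    case (elim r)
    then have "of_real r * cis t \<in> ball 0 1" by (simp add: norm_mult)
    then show ?case using conjugacy by (simp add: mult_ac flip: cis_mult)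
  qed
  ultimately show ?thesis unfolding lands_def by (rule Lim_transform_eventually)
qed

lemma lands_rotate_funpow:
  assumes "lands t q"
  shows "lands (t + 2 * pi * (n * \<theta>)) ((f ^^ n) q)"
proof (induction n)
  case (Suc n)
  from lands_rotate[OF this] show ?case by (simp add: algebra_simps)
qed (use assms in simp)

lemma landing_dense:
  assumes "lands a q" "s < t"
  shows "\<exists>u q'. s < u \<and> u < t \<and> lands u q'"
proof -
  obtain n :: nat and k :: int where u: "s < a + 2 * pi * (n * \<theta> + k)" "a + 2 * pi * (n * \<theta> + k) < t"
    using irrational_angles_dense[OF irrational assms(2)] by blast
  have "lands (a + 2 * pi * (n * \<theta> + k)) ((f ^^ n) q)"
    using lands_rotate_funpow[OF assms(1), of n] unfolding lands_def cis_shift_int .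
  then show ?thesis using u by blast
qed

lemma limit_rotate:
  assumes "(\<phi> \<longlongrightarrow> v) (at (cis t) within ball 0 1)"
  shows "(\<phi> \<longlongrightarrow> f v) (at (cis (t + 2 * pi * \<theta>)) within ball 0 1)"
proof -
  let ?T = "cis (t + 2 * pi * \<theta>)" and ?\<rho> = "cis (- (2 * pi * \<theta>))"
  have "((\<lambda>z. ?\<rho> * z) \<longlongrightarrow> ?\<rho> * ?T) (at ?T within ball 0 1)"
    by (intro tendsto_intros)
  then have lim: "((\<lambda>z. ?\<rho> * z) \<longlongrightarrow> cis t) (at ?T within ball 0 1)"
    by (simp add: cis_mult)
  have inball: "\<forall>\<^sub>F z in at ?T within ball 0 1. z \<in> ball 0 1"
    by (simp add: eventually_at_topological) auto
  then have "\<forall>\<^sub>F z in at ?T within ball 0 1. ?\<rho> * z \<in> ball 0 1 \<and> ?\<rho> * z \<noteq> cis t"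
    by eventually_elim (auto simp: norm_mult dest: arg_cong[of _ _ norm])
  then have "filterlim (\<lambda>z. ?\<rho> * z) (at (cis t) within ball 0 1) (at ?T within ball 0 1)"
    using lim by (simp add: filterlim_at)
  then have "((\<lambda>z. \<phi> (?\<rho> * z)) \<longlongrightarrow> v) (at ?T within ball 0 1)"
    by (rule filterlim_compose[OF assms])
  then have "((\<lambda>z. f (\<phi> (?\<rho> * z))) \<longlongrightarrow> f v) (at ?T within ball 0 1)"
    by (rule isCont_tendsto_compose[OF isCont_f])
  moreover have "\<forall>\<^sub>F z in at ?T within ball 0 1. f (\<phi> (?\<rho> * z)) = \<phi> z"
    using inball
  proof eventually_elim
    case (elim z)
    then have "?\<rho> * z \<in> ball 0 1" by (simp add: norm_mult)
    from conjugacy[OF this] show ?case by (simp add: cis_mult flip: mult.assoc)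
  qed
  ultimately show ?thesis by (rule Lim_transform_eventually)
qed

lemma limit_rotate_funpow:
  assumes "(\<phi> \<longlongrightarrow> v) (at (cis t) within ball 0 1)"
  shows "(\<phi> \<longlongrightarrow> (f ^^ n) v) (at (cis (t + 2 * pi * (n * \<theta>))) within ball 0 1)"
proof (induction n)
  case (Suc n)
  from limit_rotate[OF this] show ?case by (simp add: algebra_simps)
qed (use assms in simp)

text \<open>The rotation spreads boundary limits from an arc to the whole circle: some \<open>n\<close>-fold backward
  rotation takes the given point into the arc, and \<open>f ^^ n\<close> carries the limit found there forward.\<close>

lemma limits_everywhere:
  assumes "a < b" and lim: "\<And>\<tau>. \<lbrakk>a < \<tau>; \<tau> < b\<rbrakk> \<Longrightarrow> \<exists>v. (\<phi> \<longlongrightarrow> v) (at (cis \<tau>) within ball 0 1)"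
  shows "\<exists>v. (\<phi> \<longlongrightarrow> v) (at (cis t) within ball 0 1)"
proof -
  have "- \<theta> \<notin> \<rat>" using irrational by (metis Rats_minus_iff)
  then obtain n :: nat and k :: int
    where u: "a < t + 2 * pi * (n * (- \<theta>) + k)" "t + 2 * pi * (n * (- \<theta>) + k) < b"
    using irrational_angles_dense[OF _ assms(1)] by blast
  define \<tau> where "\<tau> = t + 2 * pi * (n * (- \<theta>) + k)"
  obtain v where "(\<phi> \<longlongrightarrow> v) (at (cis \<tau>) within ball 0 1)"
    using lim u unfolding \<tau>_def by blast
  from limit_rotate_funpow[OF this, of n]
  have "(\<phi> \<longlongrightarrow> (f ^^ n) v) (at (cis (\<tau> + 2 * pi * (n * \<theta>))) within ball 0 1)" .
  moreover have "cis (\<tau> + 2 * pi * (n * \<theta>)) = cis (t + 2 * pi * (0 + of_int k))"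
    by (rule arg_cong[of _ _ cis]) (simp add: \<tau>_def algebra_simps)
  ultimately show ?thesis unfolding cis_shift_int by auto
qed

text \<open>The loop made of the two rays and the arc encloses the image of one of the two sectors between
  the rays; in the second case the roles of the rays are exchanged, with the first angle increased
  by \<open>2 * pi\<close> and the arc reversed.\<close>

theorem frontier_jordan:
  assumes ab: "a < b" "b < a + 2 * pi" and la: "lands a (pathstart g)" and lb: "lands b (pathfinish g)"
    and g: "arc g" "path_image g \<subseteq> frontier \<Omega>"
  shows "frontier \<Omega> homeomorphic sphere (0::complex) 1"
proof (rule frontier_homeomorphic_circle)
  fix t
  obtain c where c: "simple_path c" "pathfinish c = pathstart c"
    "path_image c = \<phi> ` (radius a \<union> radius b) \<union> path_image g"
    using rays_arc_loop[OF ab la lb g] by blast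
  have dense: "\<exists>u q. s < u \<and> u < t \<and> lands u q" if "s < t" for s t
    using landing_dense[OF la that] .
  from loop_inside[OF c g(2) ab]
  show "\<exists>v. (\<phi> \<longlongrightarrow> v) (at (cis t) within ball 0 1)"
  proof
    assume inside: "inside (path_image c) = \<phi> ` sector a b"
    show ?thesis
      by (rule limits_everywhere[OF ab(1)])
        (rule boundary_limit[OF ab g la[unfolded pathstart_def] lb[unfolded pathfinish_def] c inside dense])
  next
    assume inside: "inside (path_image c) = \<phi> ` sector b (a + 2 * pi)"
    have ab': "a + 2 * pi < b + 2 * pi" using ab by simp
    have g': "arc (reversepath g)" "path_image (reversepath g) \<subseteq> frontier \<Omega>"
      using g by (simp_all add: arc_reversepath)
    have la': "lands (a + 2 * pi) (reversepath g 1)" "lands b (reversepath g 0)"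
      using la lb by (simp_all add: reversepath_def pathstart_def pathfinish_def)
    have c': "path_image c = \<phi> ` (radius b \<union> radius (a + 2 * pi)) \<union> path_image (reversepath g)"
      using c(3) by (simp add: Un_commute)
    show ?thesis
      by (rule limits_everywhere[OF ab(2)])
        (rule boundary_limit[OF ab(2) ab' g' la'(2,1) c(1,2) c' inside dense])
  qed
qed

end

section \<open>The plane inside the Riemann sphere\<close>

text \<open>Stereographic projection from the north pole, the inverse of \<open>stereo\<close> on the finite points; it is
  given by a formula to make its continuity evident. At \<open>Infty\<close> its value is the junk value of a
  division by zero.\<close>

definition plane_of :: "rsphere \<Rightarrow> complex" where
  "plane_of x = fst (stereo x) / of_real (1 - snd (stereo x))"

lemma one_plus_norm_pos: "0 < 1 + (norm (z::complex))\<^sup>2"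
  by (rule add_pos_nonneg) auto

lemma one_minus_height: "1 - snd (stereo (Fin z)) = 2 / (1 + (norm z)\<^sup>2)"
  using one_plus_norm_pos[of z] by (simp add: field_simps)

lemma plane_of_Fin [simp]: "plane_of (Fin z) = z"
proof -
  have "of_real (1 + (norm z)\<^sup>2) \<noteq> (0 :: complex)"
    using one_plus_norm_pos[of z] by (metis less_irrefl of_real_eq_0_iff)
  then show ?thesis
    unfolding plane_of_def one_minus_height by (simp add: of_real_divide)
qed

lemma tendsto_rsphere_iff:
  "(g \<longlongrightarrow> (l::rsphere)) F \<longleftrightarrow> ((\<lambda>x. stereo (g x)) \<longlongrightarrow> stereo l) F"
  by (simp add: tendsto_iff dist_rsphere_def)

lemma tendsto_Fin:
  assumes "(f \<longlongrightarrow> l) F"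
  shows "((\<lambda>x. Fin (f x)) \<longlongrightarrow> Fin l) F"
proof -
  have "1 + (norm l)\<^sup>2 \<noteq> 0" using one_plus_norm_pos[of l] by simp
  moreover from this have "complex_of_real (1 + (norm l)\<^sup>2) \<noteq> 0"
    by (metis of_real_eq_0_iff)
  ultimately show ?thesis
    unfolding tendsto_rsphere_iff stereo.simps
    by (intro tendsto_intros assms)
qed

lemma tendsto_plane_of:
  assumes "(g \<longlongrightarrow> Fin l) F"
  shows "((\<lambda>x. plane_of (g x)) \<longlongrightarrow> l) F"
proof -
  have lim: "((\<lambda>x. stereo (g x)) \<longlongrightarrow> stereo (Fin l)) F"
    using assms by (simp only: tendsto_rsphere_iff)
  have "1 - snd (stereo (Fin l)) \<noteq> 0"
    unfolding one_minus_height using one_plus_norm_pos[of l] by simp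
  then have "complex_of_real (1 - snd (stereo (Fin l))) \<noteq> 0"
    by (metis of_real_eq_0_iff)
  then have "((\<lambda>x. plane_of (g x)) \<longlongrightarrow> plane_of (Fin l)) F"
    unfolding plane_of_def by (intro tendsto_intros lim)
  then show ?thesis by simp
qed

lemma continuous_on_Fin: "continuous_on S Fin"
  unfolding continuous_on_def by (auto intro!: tendsto_Fin tendsto_ident_at)

lemma continuous_on_plane_of: "continuous_on (range Fin) plane_of"
  unfolding continuous_on_def by (auto intro!: tendsto_plane_of tendsto_ident_at)

lemma open_range_Fin: "open (range Fin)"
proof -
  have "range Fin = - {Infty}"
  proof (intro set_eqI iffI)
    fix x assume "x \<in> - {Infty}"
    then show "x \<in> range Fin" by (cases x) auto
  qed auto
  then show ?thesis by (simp add: open_Compl)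
qed

lemma open_Fin_image:
  assumes "open W"
  shows "open (Fin ` W)"
proof -
  have "open (plane_of -` W \<inter> range Fin)"
    using continuous_on_open_vimage[OF open_range_Fin] continuous_on_plane_of assms by blast
  moreover have "plane_of -` W \<inter> range Fin = Fin ` W" by auto
  ultimately show ?thesis by simp
qed

lemma homeomorphic_Fin_image: "S homeomorphic Fin ` S"
  unfolding homeomorphic_minimal
  by (intro exI[of _ Fin] exI[of _ plane_of])
    (auto intro: continuous_on_Fin continuous_on_subset[OF continuous_on_plane_of])

lemma frontier_Fin_image:
  assumes "bounded S" "open S"
  shows "frontier (Fin ` S) = Fin ` frontier S"
proof -
  have "compact (Fin ` closure S)"
    using assms(1) by (intro compact_continuous_image continuous_on_Fin) simp
  then have "closed (Fin ` closure S)" by (rule compact_imp_closed)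
  then have "closure (Fin ` S) \<subseteq> Fin ` closure S"
    by (intro closure_minimal) (auto simp: closure_subset[THEN subsetD])
  moreover have "Fin ` closure S \<subseteq> closure (Fin ` S)"
    by (rule continuous_image_closure_subset[OF continuous_on_Fin[of UNIV]]) simp
  ultimately have "closure (Fin ` S) = Fin ` closure S" by blast
  then show ?thesis
    using open_Fin_image[OF assms(2)] assms(2)
    by (auto simp: frontier_def interior_open)
qed

section \<open>Bounded orbits and the Fatou set\<close>

lemma funpow_sphere_map: "(sphere_map p ^^ n) (Fin z) = Fin ((poly p ^^ n) z)"
  by (induction n) auto

lemma holomorphic_poly_funpow: "(poly p ^^ n) holomorphic_on S"
proof -
  have "(poly p ^^ n) holomorphic_on UNIV"
  proof (induction n)
    case (Suc n)
    have "poly p \<circ> (poly p ^^ n) holomorphic_on UNIV"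
      by (rule holomorphic_on_compose[OF Suc]) (intro holomorphic_intros)
    then show ?case by (simp only: funpow.simps)
  next
    case 0
    show ?case by (simp add: id_def holomorphic_on_ident)
  qed
  then show ?thesis by (rule holomorphic_on_subset) simp
qed

text \<open>Montel's theorem in the plane, carried over to the chordal metric: \<open>Fin\<close> is uniformly continuous on
  the disk that contains all orbits.\<close>

lemma bounded_orbits_in_fatou_set:
  assumes "open W" and bd: "\<And>n z. z \<in> W \<Longrightarrow> norm ((poly p ^^ n) z) \<le> M"
  shows "Fin ` W \<subseteq> fatou_set (sphere_map p)"
proof -
  have "normal_family_on (Fin ` W) (range (\<lambda>n. sphere_map p ^^ n))"
    unfolding normal_family_on_def
  proof (intro allI impI)
    fix g :: "nat \<Rightarrow> rsphere \<Rightarrow> rsphere"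
    assume "range g \<subseteq> range (\<lambda>n. sphere_map p ^^ n)"
    then have "\<forall>k. \<exists>n. g k = sphere_map p ^^ n" by blast
    then obtain m where m: "\<And>k. g k = sphere_map p ^^ m k" by metis
    obtain h r where h: "h holomorphic_on W" "strict_mono (r :: nat \<Rightarrow> nat)"
      "\<And>x. x \<in> W \<Longrightarrow> (\<lambda>n. (poly p ^^ m (r n)) x) \<longlonglongrightarrow> h x"
      "\<And>K. \<lbrakk>compact K; K \<subseteq> W\<rbrakk> \<Longrightarrow> uniform_limit K ((\<lambda>k. poly p ^^ m k) \<circ> r) h sequentially"
    proof (rule Montel[OF assms(1), of "range (\<lambda>n. poly p ^^ n)" "\<lambda>k. poly p ^^ m k"])
      show "\<And>h. h \<in> range (\<lambda>n. poly p ^^ n) \<Longrightarrow> h holomorphic_on W"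
        using holomorphic_poly_funpow by auto
      show "\<exists>B. \<forall>h\<in>range (\<lambda>n. poly p ^^ n). \<forall>z\<in>K. norm (h z) \<le> B" if "K \<subseteq> W" for K
        using bd that by blast
    qed auto
    have h_bd: "norm (h z) \<le> M" if "z \<in> W" for z
      by (rule LIMSEQ_le_const2[OF tendsto_norm[OF h(3)[OF that]]]) (use bd[OF that] in auto)
    have uc: "uniformly_continuous_on (cball 0 M) Fin"
      by (intro compact_uniformly_continuous continuous_on_Fin compact_cball)
    have "uniform_limit K (\<lambda>n. g (r n)) (\<lambda>x. Fin (h (plane_of x))) sequentially"
      if K: "compact K" "K \<subseteq> Fin ` W" for K
      unfolding uniform_limit_iff
    proof (intro allI impI)
      fix e :: real assume "e > 0"
      then obtain d where d: "d > 0"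
        "\<And>x y. \<lbrakk>x \<in> cball 0 M; y \<in> cball 0 M; dist y x < d\<rbrakk> \<Longrightarrow> dist (Fin y) (Fin x) < e"
        using uc unfolding uniformly_continuous_on_def by metis
      have K': "plane_of ` K \<subseteq> W" "compact (plane_of ` K)"
        using K by (auto intro!: compact_continuous_image continuous_on_subset[OF continuous_on_plane_of])
      have "\<forall>\<^sub>F n in sequentially. \<forall>x\<in>plane_of ` K. dist ((poly p ^^ m (r n)) x) (h x) < d"
        using h(4)[OF K'(2,1)] d(1) by (simp add: uniform_limit_iff)
      then show "\<forall>\<^sub>F n in sequentially. \<forall>x\<in>K. dist (g (r n) x) (Fin (h (plane_of x))) < e"
      proof eventually_elim
        case (elim n)
        show ?case
        proof
          fix x assume "x \<in> K"
          then obtain z where z: "x = Fin z" "z \<in> W" using K(2) by auto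
          then have "dist ((poly p ^^ m (r n)) z) (h z) < d"
            using elim \<open>x \<in> K\<close> by (metis image_eqI plane_of_Fin)
          then have "dist (Fin ((poly p ^^ m (r n)) z)) (Fin (h z)) < e"
            using bd[OF z(2)] h_bd[OF z(2)] by (intro d(2)) auto
          then show "dist (g (r n) x) (Fin (h (plane_of x))) < e"
            by (simp add: z(1) m funpow_sphere_map)
        qed
      qed
    qed
    then show "\<exists>r h. strict_mono r \<and> (\<forall>K. compact K \<and> K \<subseteq> Fin ` W \<longrightarrow>
        uniform_limit K (\<lambda>n. g (r n)) h sequentially)"
      using h(2) by blast
  qed
  then show ?thesis
    unfolding fatou_set_def using open_Fin_image[OF assms(1)] by blast
qed

lemma open_fatou_set: "open (fatou_set f)"
proof -
  have "\<exists>U. open U \<and> x \<in> U \<and> U \<subseteq> fatou_set f" if "x \<in> fatou_set f" for x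
    using that unfolding fatou_set_def by blast
  then show ?thesis by (subst open_subopen) blast
qed

text \<open>A small disk around a Fatou point on the frontier would be a connected part of the Fatou set
  meeting the component, hence would lie inside it.\<close>

lemma component_frontier_Int_fatou_set:
  assumes G: "Fin ` S \<in> components (fatou_set f)" and z: "z \<in> frontier S"
  shows "Fin z \<notin> fatou_set f"
proof
  assume "Fin z \<in> fatou_set f"
  have "open (Fin -` fatou_set f)"
    using open_vimage[OF open_fatou_set] continuous_on_Fin by blast
  then obtain e where e: "e > 0" "ball z e \<subseteq> Fin -` fatou_set f"
    using \<open>Fin z \<in> fatou_set f\<close> open_contains_ball by (metis vimage_eq)
  have "z \<in> closure S" using z by (simp add: frontier_def)
  then obtain y where "y \<in> S" "dist y z < e"
    using e(1) unfolding closure_approachable by blast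
  then have "y \<in> ball z e \<inter> S" by (simp add: dist_commute)
  then have "Fin ` S \<inter> Fin ` ball z e \<noteq> {}" by blast
  moreover have "connected (Fin ` ball z e)"
    by (intro connected_continuous_image continuous_on_Fin connected_ball)
  ultimately have "Fin ` ball z e \<subseteq> Fin ` S"
    using components_maximal[OF G] e(2) by blast
  then have "ball z e \<subseteq> S" by auto
  then have "z \<in> interior S" using e(1) by (meson centre_in_ball interior_maximal open_ball subsetD)
  then show False using z by (simp add: frontier_def)
qed

lemma escape_radius:
  fixes p :: "complex poly"
  assumes "degree p \<ge> 2"
  obtains R where "R > 0" "\<And>z. norm z \<ge> R \<Longrightarrow> norm (poly p z) \<ge> 2 * norm z"
proof -
  obtain a q where p: "p = pCons a q" by (cases p) auto
  obtain b q' where q: "q = pCons b q'" by (cases q) auto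
  have "q' \<noteq> 0" using assms by (auto simp: p q degree_pCons_eq_if split: if_splits)
  then obtain r where r: "\<And>z. r \<le> norm z \<Longrightarrow> 3 \<le> norm (poly (pCons b q') z)"
    using poly_infinity[of q' 3 b] by (metis)
  show ?thesis
  proof
    show "max 1 (max r (norm a)) > 0" by simp
    fix z :: complex assume z: "norm z \<ge> max 1 (max r (norm a))"
    have "norm z * 3 \<le> norm z * norm (poly q z)"
      using r[of z] z by (intro mult_left_mono) (auto simp: q)
    also have "\<dots> = norm (poly p z - a)" by (simp add: p norm_mult)
    also have "\<dots> \<le> norm (poly p z) + norm a" by (rule norm_triangle_ineq4)
    finally show "norm (poly p z) \<ge> 2 * norm z" using z by simp
  qed
qed

lemma escaping_orbit:
  fixes p :: "complex poly"
  assumes R: "R > 0" "\<And>z. norm z \<ge> R \<Longrightarrow> norm (poly p z) \<ge> 2 * norm z" and z: "norm z \<ge> R"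
  shows "norm ((poly p ^^ n) z) \<ge> 2 ^ n * R"
proof (induction n)
  case (Suc n)
  have "R \<le> 2 ^ n * R" using R(1) by simp
  then show ?case using R(2)[of "(poly p ^^ n) z"] Suc by simp
qed (use z in simp)

lemma poly_funpow_eq_poly:
  fixes p :: "'a::idom poly"
  obtains q where "poly q = poly p ^^ n" "degree q = degree p ^ n"
proof -
  have "\<exists>q. poly q = poly p ^^ n \<and> degree q = degree p ^ n"
  proof (induction n)
    case 0
    show ?case by (intro exI[of _ "[:0, 1:]"]) (auto simp: fun_eq_iff)
  next
    case (Suc n)
    then obtain q where "poly q = poly p ^^ n" "degree q = degree p ^ n" by blast
    then show ?case
      by (intro exI[of _ "pcompose p q"]) (auto simp: fun_eq_iff poly_pcompose degree_pcompose)
  qed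
  then show ?thesis using that by blast
qed

section \<open>Siegel disks of polynomials\<close>

theorem theorem1p2:
  fixes p :: "complex poly" and w\<^sub>0 :: complex and G A :: "rsphere set"
    and \<theta> :: real and \<phi> :: "complex \<Rightarrow> complex" and \<zeta>\<^sub>1 \<zeta>\<^sub>2 :: complex
  assumes "degree p \<ge> 2"
    and "siegel_disk p w\<^sub>0 G"
    and "siegel_riemann_map p w\<^sub>0 G \<theta> \<phi>"
    and "is_arc A" and "A \<subseteq> frontier G"
    and "norm \<zeta>\<^sub>1 = 1" and "norm \<zeta>\<^sub>2 = 1"
    and "internal_ray \<phi> \<zeta>\<^sub>1 \<noteq> internal_ray \<phi> \<zeta>\<^sub>2"
    and "ray_lands_on \<phi> \<zeta>\<^sub>1 A" and "ray_lands_on \<phi> \<zeta>\<^sub>2 A"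
  shows "is_jordan_curve (frontier G)"
proof -
  define D where "D = \<phi> ` ball 0 1"
  define \<rho> where "\<rho> = cis (2 * pi * \<theta>)"
  have \<rho>: "exp (2 * of_real pi * \<i> * of_real \<theta>) = \<rho>"
    by (simp add: \<rho>_def cis_conv_exp mult_ac)
  have hol: "\<phi> holomorphic_on ball 0 1" and bij: "bij_betw (\<lambda>z. Fin (\<phi> z)) (ball 0 1) G"
    and conj: "\<And>z. z \<in> ball 0 1 \<Longrightarrow> poly p (\<phi> z) = \<phi> (\<rho> * z)"
    using assms(3) unfolding siegel_riemann_map_def conjugates_rotation_def \<rho> by auto
  have comp: "G \<in> components (fatou_set (sphere_map p))"
    using assms(2) by (simp add: siegel_disk_def)
  have inj: "inj_on \<phi> (ball 0 1)"
    using bij by (auto simp: bij_betw_def inj_on_def)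
  have G: "G = Fin ` D"
    using bij by (auto simp: bij_betw_def D_def)
  have "open D" unfolding D_def by (rule open_mapping_thm3[OF hol _ inj]) simp
  have orbit: "(poly p ^^ n) (\<phi> z) = \<phi> (\<rho> ^ n * z)" if "z \<in> ball 0 1" for n z
  proof (induction n)
    case (Suc n)
    have "\<rho> ^ n * z \<in> ball 0 1" using that by (simp add: \<rho>_def norm_mult norm_power)
    then show ?case using Suc conj by (simp add: mult.assoc)
  qed simp
  have norm_\<rho>: "norm (\<rho> ^ n) = 1" for n by (simp add: \<rho>_def norm_power)

  \<comment> \<open>For rational \<open>\<theta>\<close> some iterate would fix every point of \<open>D\<close>, although it is a polynomial of degree
    at least 2.\<close>
  have "\<theta> \<notin> \<rat>"
  proof
    assume "\<theta> \<in> \<rat>"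
    then obtain i :: int and n :: nat where n: "n > 0" "\<theta> = i / n"
      by (metis Rats_cases' of_int_of_nat_eq zero_less_imp_eq_int)
    have "real n * (2 * pi * \<theta>) = 0 + 2 * pi * (0 + of_int i)"
      using n by simp
    then have "\<rho> ^ n = cis (0 + 2 * pi * (0 + of_int i))"
      unfolding \<rho>_def Complex.DeMoivre by (rule arg_cong)
    then have "\<rho> ^ n = 1" unfolding cis_shift_int by simp
    obtain q where q: "poly q = poly p ^^ n" "degree q = degree p ^ n"
      using poly_funpow_eq_poly[where p = p and n = n] by blast
    have "poly (q - [:0, 1:]) w = 0" if "w \<in> D" for w
      using that orbit[of _ n] \<open>\<rho> ^ n = 1\<close> by (auto simp: D_def q(1))
    then have "D \<subseteq> {w. poly (q - [:0, 1:]) w = 0}" by blast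
    moreover have "infinite D"
      using finite_imp_not_open[of D] \<open>open D\<close> by (auto simp: D_def)
    ultimately have "q - [:0, 1:] = 0" using poly_roots_finite finite_subset by blast
    then have "degree q = 1" by simp
    moreover have "degree q \<ge> 2"
      unfolding q(2) using assms(1) n(1) self_le_power[of "degree p" n] by simp
    ultimately show False by simp
  qed

  \<comment> \<open>The disk is bounded because the orbit of \<open>\<phi> z\<close> stays on the image of a circle, a compact set,
    whereas orbits from beyond the escape radius tend to infinity.\<close>
  obtain R where R: "R > 0" "\<And>z. norm z \<ge> R \<Longrightarrow> norm (poly p z) \<ge> 2 * norm z"
    using escape_radius[OF assms(1)] by blast
  have D_bd: "norm w \<le> R" if "w \<in> D" for w
  proof (rule ccontr)
    assume "\<not> norm w \<le> R"
    then have "norm w \<ge> R" by simp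
    obtain z where z: "w = \<phi> z" "z \<in> ball 0 1" using \<open>w \<in> D\<close> by (auto simp: D_def)
    have "compact (\<phi> ` sphere 0 (norm z))"
      using z(2) by (intro compact_continuous_image continuous_on_subset[OF holomorphic_on_imp_continuous_on[OF hol]]) auto
    then have "bounded (\<phi> ` sphere 0 (norm z))" by (rule compact_imp_bounded)
    then obtain B where B: "\<And>x. x \<in> sphere 0 (norm z) \<Longrightarrow> norm (\<phi> x) \<le> B"
      by (meson bounded_iff imageI)
    obtain n where "B / R < 2 ^ n" using real_arch_pow[of 2 "B / R"] by auto
    then have "B < 2 ^ n * R" using R(1) by (simp add: field_simps)
    also have "\<dots> \<le> norm ((poly p ^^ n) w)"
      by (rule escaping_orbit[OF R \<open>norm w \<ge> R\<close>])
    also have "\<dots> \<le> B"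
      unfolding z(1) orbit[OF z(2)] by (intro B) (simp add: norm_mult norm_\<rho>)
    finally show False by simp
  qed
  then have "bounded D" by (auto simp: bounded_iff)

  have rot: "(poly p ^^ n) ` D \<subseteq> D" for n
  proof -
    have "\<phi> (\<rho> ^ n * z) \<in> D" if "z \<in> ball 0 1" for z
      unfolding D_def using that by (intro imageI) (simp add: norm_mult norm_\<rho>)
    then show ?thesis using orbit by (auto simp: D_def)
  qed
  have clD: "norm ((poly p ^^ n) w) \<le> R" if "w \<in> closure D" for n w
  proof -
    have "(poly p ^^ n) ` closure D \<subseteq> closure ((poly p ^^ n) ` D)"
      by (rule continuous_image_closure_subset[of UNIV])
        (auto intro: holomorphic_on_imp_continuous_on holomorphic_poly_funpow)
    also have "\<dots> \<subseteq> cball 0 R"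
      by (rule closure_minimal) (use rot[of n] D_bd in auto)
    finally show ?thesis using that by auto
  qed
  \<comment> \<open>On a loop in \<open>closure D\<close> all iterates are bounded by \<open>R\<close>; by the maximum principle this
    persists inside the loop, so the inside lies in the Fatou set.\<close>
  interpret rotation_disk \<phi> "poly p" \<theta>
  proof
    show "inside (path_image c) \<inter> frontier (\<phi> ` ball 0 1) = {}"
      if c: "simple_path c" "pathfinish c = pathstart c" "path_image c \<subseteq> closure (\<phi> ` ball 0 1)" for c
    proof -
      let ?I = "inside (path_image c)"
      have I: "open ?I" "bounded ?I" "frontier ?I = path_image c"
        using Jordan_inside_outside[OF c(1,2)] by auto
      have "norm ((poly p ^^ n) z) \<le> R" if "z \<in> ?I" for n z
      proof (rule maximum_modulus_frontier[OF _ _ I(2) _ that])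
        show "(poly p ^^ n) holomorphic_on interior ?I" by (rule holomorphic_poly_funpow)
        show "continuous_on (closure ?I) (poly p ^^ n)"
          by (rule holomorphic_on_imp_continuous_on[OF holomorphic_poly_funpow])
        show "\<And>z. z \<in> frontier ?I \<Longrightarrow> norm ((poly p ^^ n) z) \<le> R"
          using clD c(3) I(3) by (auto simp: D_def)
      qed
      then have "Fin ` ?I \<subseteq> fatou_set (sphere_map p)"
        by (rule bounded_orbits_in_fatou_set[OF I(1)])
      then show ?thesis
        using component_frontier_Int_fatou_set[of D "sphere_map p"] comp by (auto simp: G D_def)
    qed
    show "continuous_on UNIV (poly p)" by (intro continuous_intros)
  qed (use hol inj \<open>bounded D\<close> \<open>\<theta> \<notin> \<rat>\<close> conj in \<open>auto simp: D_def \<rho>_def\<close>)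

  have fr: "frontier G = Fin ` frontier D"
    unfolding G by (rule frontier_Fin_image) fact+
  obtain h where h: "continuous_on {0..1} h" "h ` {0..1::real} = A" "inj_on h {0..1}"
  proof -
    have "{0..1::real} homeomorphic A" using assms(4) unfolding is_arc_def by (rule homeomorphic_sym[THEN iffD1])
    then obtain f g where hom: "homeomorphism {0..1::real} A f g" unfolding homeomorphic_def by blast
    then have "inj_on f {0..1}" unfolding homeomorphism_def inj_on_def by metis
    then show ?thesis
      by (rule that[of f, rotated 2]) (use hom in \<open>auto simp: homeomorphism_def\<close>)
  qed
  define g where "g = plane_of \<circ> h"
  have AF: "A \<subseteq> Fin ` frontier D" using assms(5) fr by simp
  have Fg: "Fin (g s) = h s" if "s \<in> {0..1}" for s
  proof -
    have "h s \<in> A" using h(2) that by blast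
    then show ?thesis using AF by (auto simp: g_def)
  qed
  have "arc g"
    unfolding arc_def path_def
  proof
    show "continuous_on {0..1} g"
      unfolding g_def using AF h(2)
      by (intro continuous_on_compose h(1) continuous_on_subset[OF continuous_on_plane_of]) auto
    show "inj_on g {0..1}"
      using h(3) Fg unfolding inj_on_def by metis
  qed
  have "path_image g \<subseteq> frontier D"
  proof -
    have "g s \<in> frontier D" if "s \<in> {0..1}" for s
      using Fg[OF that] AF h(2) that by (metis image_eqI image_iff rsphere.inject subsetD)
    then show ?thesis by (auto simp: path_image_def)
  qed
  have landing: "\<exists>s\<in>{0..1}. lands (Arg \<zeta>) (g s)" if ray: "norm \<zeta> = 1" "ray_lands_on \<phi> \<zeta> A" for \<zeta>
  proof -
    have "\<zeta> \<noteq> 0" using ray(1) by auto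
    then have \<zeta>: "cis (Arg \<zeta>) = \<zeta>" using ray(1) by (simp add: cis_Arg sgn_eq)
    obtain a where a: "a \<in> A" "((\<lambda>r. Fin (\<phi> (of_real r * \<zeta>))) \<longlongrightarrow> a) (at_left 1)"
      using ray(2) unfolding ray_lands_on_def by blast
    obtain s where s: "s \<in> {0..1}" "h s = a" using a(1) h(2) by blast
    have "((\<lambda>r. plane_of (Fin (\<phi> (of_real r * \<zeta>)))) \<longlongrightarrow> g s) (at_left 1)"
      by (rule tendsto_plane_of) (use a(2) s Fg in simp)
    then show ?thesis using s(1) unfolding lands_def \<zeta> by auto
  qed
  have conclude: "frontier D homeomorphic sphere (0::complex) 1"
    if xy: "norm x = 1" "norm y = 1" "ray_lands_on \<phi> x A" "ray_lands_on \<phi> y A" "Arg x < Arg y" for x y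
  proof -
    have lt: "Arg y < Arg x + 2 * pi" using Arg_bounded[of x] Arg_bounded[of y] by simp
    obtain s where s: "s \<in> {0..1}" "lands (Arg x) (g s)" using landing xy by blast
    obtain t where t: "t \<in> {0..1}" "lands (Arg y) (g t)" using landing xy by blast
    have "s \<noteq> t" using rays_landing_same_point[OF xy(5) lt s(2)] t(2) by auto
    show ?thesis
      unfolding D_def
    proof (rule frontier_jordan[OF xy(5) lt])
      show "arc (subpath s t g)"
        by (rule arc_subpath_arc[OF \<open>arc g\<close>]) (use s t \<open>s \<noteq> t\<close> in auto)
      show "path_image (subpath s t g) \<subseteq> frontier (\<phi> ` ball 0 1)"
        using path_image_subpath_subset[of s t g] s(1) t(1) \<open>path_image g \<subseteq> frontier D\<close>
        unfolding D_def by blast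
    qed (use s t in auto)
  qed
  have "\<zeta>\<^sub>1 \<noteq> \<zeta>\<^sub>2" using assms(8) by auto
  then have "Arg \<zeta>\<^sub>1 \<noteq> Arg \<zeta>\<^sub>2"
    using assms(6,7) by (metis rcis_cmod_Arg)
  then have "frontier D homeomorphic sphere (0::complex) 1"
    using conclude[of \<zeta>\<^sub>1 \<zeta>\<^sub>2] conclude[of \<zeta>\<^sub>2 \<zeta>\<^sub>1] assms(6,7,9,10) by (meson linorder_neqE)
  then have "Fin ` frontier D homeomorphic sphere (0::complex) 1"
    by (rule homeomorphic_trans[OF homeomorphic_sym[THEN iffD1, OF homeomorphic_Fin_image]])
  then show ?thesis
    unfolding is_jordan_curve_def fr .
qed

end
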